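(* Fix $r\in\mathbb N$ and a compact interval $[t_0,t_1]\subset\mathbb R$, and let all processes be defined on a probability space $(\Omega,\mathcal F,\mathbb P)$. Let $f_0\sim\mathcal{GP}(\mu,C_\theta)$ on $[t_0,t_1]$ with $\mu\in C^r([t_0,t_1])$ and $C_\theta\in C^{r,r}([t_0,t_1]^2)$, and assume that $f_0$ has a version $f_0^\ast$ whose sample paths lie in $C^r([t_0,t_1])$ almost surely. Let $\boldsymbol\kappa=(\kappa_1,\ldots,\kappa_r)^\top$ be square-integrable random variables. For $p=-r,\ldots,-1$ let $f_p$ be the $(-p)$th mean-square derivative process of $f_0$, and for $p=1,\ldots,r$ let $$f_p(t):=\frac{1}{(p-1)!}\int_{t_0}^t (t-u)^{p-1}f_0(u)\,du+\sum_{j=1}^{p}\frac{(t-t_0)^{p-j}}{(p-j)!}\kappa_j,\qquad t\in[t_0,t_1],$$ with the integral understood as an $L^2$-random variable. Then $D_t^kf_0^\ast$ is a version of $f_{-k}$ for each $k=1,\ldots,r$. Assume further that $f_0$ and $f_0^\ast$ are jointly measurable on $[t_0,t_1]\times\Omega$ with $\int_{t_0}^{t_1}\mathbb E\big[|f_0(u)|+|f_0^\ast(u)|\big]du<\infty$. Then there are versions of $f_{-r},\ldots,f_r$, denoted by the same symbols, and an event $\Omega_\ast$ with $\mathbb P(\Omega_\ast)=1$ such that for every $\omega\in\Omega_\ast$, every $p\in\{-r,\ldots,r\}$ and every $t\in[t_0,t_1]$, $$f_p(t,\omega)=(\mathcal A_{t_0}^{[p]}f_0^\ast)(t,\omega)+\mathbf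 1_{\{p>0\}}\sum_{j=1}^{p}\frac{(t-t_0)^{p-j}}{(p-j)!}\kappa_j(\omega),$$ and, for each $p=-r+1,\ldots,r$, the map $t\mapsto f_p(t,\omega)$ is differentiable on $(t_0,t_1)$ with derivative $f_{p-1}(t,\omega)$. (In particular, when $\boldsymbol\kappa\sim N(\boldsymbol\mu_\kappa,\boldsymbol\Sigma_\kappa)$ is independent of $f_0$, the joint Gaussian law of $(f_{-r},\ldots,f_r)$ is represented by processes satisfying this sample-path differential chain.)
   Context: $\mathcal{GP}(\mu,C)$ denotes a Gaussian process with mean $\mu$ and covariance function $C$. $C^{r,r}(I^2)$ is the set of functions on $I^2$ with continuous mixed derivatives $D_1^uD_2^v$ for $0\le u,v\le r$. Mean-square derivatives are $L^2(\mathbb P)$-limits of difference quotients; derivatives at the endpoints are one-sided. A process $g$ is a version of $f$ if $\mathbb P(g(t)=f(t))=1$ for every $t$. For $q>0$, $(\mathcal I_{t_0}^q f)(t)=\frac{1}{(q-1)!}\int_{t_0}^t(t-u)^{q-1}f(u)\,du$. The signed-order operator is $\mathcal A_{t_0}^{[k]}=D_t^{-k}$ for $k<0$, $\mathrm{Id}$ for $k=0$, and $\mathcal I_{t_0}^k$ for $k>0$; applied to $f_0^\ast$ it acts path by path (ordinary derivatives and integrals of the sample path). *)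

theory Defs
  imports "HOL-Probability.Probability"
begin

section \<open>Differentiability on a compact interval\<close>

text \<open>Derivatives are taken within the interval \<open>I\<close>, hence one-sided at its endpoints.\<close>

definition deriv_in :: "real set \<Rightarrow> (real \<Rightarrow> real) \<Rightarrow> real \<Rightarrow> real" where
  "deriv_in I f = (\<lambda>t. vector_derivative f (at t within I))"

definition Cr_on :: "nat \<Rightarrow> real set \<Rightarrow> (real \<Rightarrow> real) \<Rightarrow> bool" where
  "Cr_on r I f \<longleftrightarrow>
     (\<forall>k<r. (deriv_in I ^^ k) f differentiable_on I) \<and>
     continuous_on I ((deriv_in I ^^ r) f)"

definition deriv_fst :: "real set \<Rightarrow> (real \<Rightarrow> real \<Rightarrow> real) \<Rightarrow> real \<Rightarrow> real \<Rightarrow> real" where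
  "deriv_fst I G = (\<lambda>s t. deriv_in I (\<lambda>x. G x t) s)"

definition deriv_snd :: "real set \<Rightarrow> (real \<Rightarrow> real \<Rightarrow> real) \<Rightarrow> real \<Rightarrow> real \<Rightarrow> real" where
  "deriv_snd I G = (\<lambda>s t. deriv_in I (G s) t)"

definition mixed_deriv ::
    "real set \<Rightarrow> nat \<Rightarrow> nat \<Rightarrow> (real \<Rightarrow> real \<Rightarrow> real) \<Rightarrow> real \<Rightarrow> real \<Rightarrow> real" where
  "mixed_deriv I u v G = (deriv_fst I ^^ u) ((deriv_snd I ^^ v) G)"

text \<open>The class \<open>C\<^sup>r\<^sup>,\<^sup>r(I\<^sup>2)\<close>. The first two conjuncts say that every mixed derivative
  occurring in the third one exists (\<^const>\<open>vector_derivative\<close> is total).\<close>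

definition Crr_on :: "nat \<Rightarrow> real set \<Rightarrow> (real \<Rightarrow> real \<Rightarrow> real) \<Rightarrow> bool" where
  "Crr_on r I G \<longleftrightarrow>
     (\<forall>v<r. \<forall>s\<in>I. (\<lambda>t. mixed_deriv I 0 v G s t) differentiable_on I) \<and>
     (\<forall>u<r. \<forall>v\<le>r. \<forall>t\<in>I. (\<lambda>s. mixed_deriv I u v G s t) differentiable_on I) \<and>
     (\<forall>u\<le>r. \<forall>v\<le>r. continuous_on (I \<times> I) (\<lambda>(s, t). mixed_deriv I u v G s t))"


section \<open>Gaussian processes\<close>

text \<open>The normal law with mean \<open>m\<close> and standard deviation \<open>\<sigma>\<close>; it degenerates to a point mass
  for \<open>\<sigma> = 0\<close>, where \<^const>\<open>normal_density\<close> is not a probability density.\<close>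

definition normal_law :: "real \<Rightarrow> real \<Rightarrow> real measure" where
  "normal_law m \<sigma> = (if \<sigma> = 0 then return borel m else density lborel (normal_density m \<sigma>))"

definition normal_rv :: "'w measure \<Rightarrow> ('w \<Rightarrow> real) \<Rightarrow> bool" where
  "normal_rv M X \<longleftrightarrow> X \<in> borel_measurable M \<and> (\<exists>m. \<exists>\<sigma>\<ge>0. distr M borel X = normal_law m \<sigma>)"

definition jointly_gaussian :: "'w measure \<Rightarrow> 'i set \<Rightarrow> ('i \<Rightarrow> 'w \<Rightarrow> real) \<Rightarrow> bool" where
  "jointly_gaussian M T X \<longleftrightarrow>
     (\<forall>S a. finite S \<longrightarrow> S \<subseteq> T \<longrightarrow> normal_rv M (\<lambda>\<omega>. \<Sum>i\<in>S. a i * X i \<omega>))"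

definition gaussian_process ::
    "'w measure \<Rightarrow> 'i set \<Rightarrow> ('i \<Rightarrow> 'w \<Rightarrow> real) \<Rightarrow> ('i \<Rightarrow> real) \<Rightarrow> ('i \<Rightarrow> 'i \<Rightarrow> real) \<Rightarrow> bool" where
  "gaussian_process M T X \<mu> C \<longleftrightarrow>
     jointly_gaussian M T X \<and>
     (\<forall>t\<in>T. (\<integral>\<omega>. X t \<omega> \<partial>M) = \<mu> t) \<and>
     (\<forall>s\<in>T. \<forall>t\<in>T. (\<integral>\<omega>. (X s \<omega> - \<mu> s) * (X t \<omega> - \<mu> t) \<partial>M) = C s t)"

definition process_law :: "'w measure \<Rightarrow> 'i set \<Rightarrow> ('i \<Rightarrow> 'w \<Rightarrow> real) \<Rightarrow> ('i \<Rightarrow> real) measure" where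
  "process_law M T X = distr M (Pi\<^sub>M T (\<lambda>_. borel)) (\<lambda>\<omega>. \<lambda>i\<in>T. X i \<omega>)"

text \<open>Independence of two families as random elements of their product spaces;
  \<^const>\<open>prob_space.indep_var\<close> needs both random elements to have the same type.\<close>

definition independent_families ::
    "'w measure \<Rightarrow> 'i set \<Rightarrow> ('i \<Rightarrow> 'w \<Rightarrow> real) \<Rightarrow> 'j set \<Rightarrow> ('j \<Rightarrow> 'w \<Rightarrow> real) \<Rightarrow> bool" where
  "independent_families M S X T Y \<longleftrightarrow>
     prob_space.indep_set M
       (sets (vimage_algebra (space M) (\<lambda>\<omega>. \<lambda>i\<in>S. X i \<omega>) (Pi\<^sub>M S (\<lambda>_. borel))))
       (sets (vimage_algebra (space M) (\<lambda>\<omega>. \<lambda>j\<in>T. Y j \<omega>) (Pi\<^sub>M T (\<lambda>_. borel))))"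

text \<open>Almost sure equality is meant up to a null set; no measurability is demanded of \<open>g\<close>, since
  path derivatives are unconstrained on the null set of paths that are not smooth.\<close>

definition version_on ::
    "'w measure \<Rightarrow> 'i set \<Rightarrow> ('i \<Rightarrow> 'w \<Rightarrow> real) \<Rightarrow> ('i \<Rightarrow> 'w \<Rightarrow> real) \<Rightarrow> bool" where
  "version_on M T g f \<longleftrightarrow> (\<forall>t\<in>T. AE \<omega> in M. g t \<omega> = f t \<omega>)"


section \<open>Mean-square calculus\<close>

definition square_integrable :: "'w measure \<Rightarrow> ('w \<Rightarrow> real) \<Rightarrow> bool" where
  "square_integrable M X \<longleftrightarrow> X \<in> borel_measurable M \<and> integrable M (\<lambda>\<omega>. (X \<omega>)\<^sup>2)"

definition L2_tendsto :: "'w measure \<Rightarrow> ('a \<Rightarrow> 'w \<Rightarrow> real) \<Rightarrow> ('w \<Rightarrow> real) \<Rightarrow> 'a filter \<Rightarrow> bool" where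
  "L2_tendsto M X Y F \<longleftrightarrow>
     square_integrable M Y \<and> (\<forall>\<^sub>F a in F. square_integrable M (X a)) \<and>
     ((\<lambda>a. \<integral>\<omega>. (X a \<omega> - Y \<omega>)\<^sup>2 \<partial>M) \<longlongrightarrow> 0) F"

definition has_ms_derivative ::
    "'w measure \<Rightarrow> real set \<Rightarrow> (real \<Rightarrow> 'w \<Rightarrow> real) \<Rightarrow> ('w \<Rightarrow> real) \<Rightarrow> real \<Rightarrow> bool" where
  "has_ms_derivative M I f Y t \<longleftrightarrow>
     L2_tendsto M (\<lambda>s \<omega>. (f s \<omega> - f t \<omega>) / (s - t)) Y (at t within I)"

text \<open>Mean-square derivatives and integrals are unique up to almost sure equality; the following
  operators select a representative when one exists.\<close>

definition ms_deriv ::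
    "'w measure \<Rightarrow> real set \<Rightarrow> (real \<Rightarrow> 'w \<Rightarrow> real) \<Rightarrow> real \<Rightarrow> 'w \<Rightarrow> real" where
  "ms_deriv M I f = (\<lambda>t. SOME Y. has_ms_derivative M I f Y t)"

text \<open>Tagged divisions of \<open>[a, b]\<close> whose mesh tends to \<open>0\<close>. In contrast to
  \<^const>\<open>division_filter\<close> the gauge is uniform, which gives Riemann sums.\<close>

definition riemann_filter :: "real \<Rightarrow> real \<Rightarrow> (real \<times> real set) set filter" where
  "riemann_filter a b =
     (INF d\<in>{0<..}. principal {p. p tagged_division_of {a..b} \<and> (\<lambda>x. ball x d) fine p})"

definition has_ms_integral ::
    "'w measure \<Rightarrow> real \<Rightarrow> real \<Rightarrow> (real \<Rightarrow> 'w \<Rightarrow> real) \<Rightarrow> ('w \<Rightarrow> real) \<Rightarrow> bool" where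
  "has_ms_integral M a b F Y \<longleftrightarrow>
     L2_tendsto M (\<lambda>p \<omega>. \<Sum>(x, K)\<in>p. measure lborel K * F x \<omega>) Y (riemann_filter a b)"

definition ms_integral ::
    "'w measure \<Rightarrow> real \<Rightarrow> real \<Rightarrow> (real \<Rightarrow> 'w \<Rightarrow> real) \<Rightarrow> 'w \<Rightarrow> real" where
  "ms_integral M a b F = (SOME Y. has_ms_integral M a b F Y)"


section \<open>Path operators of signed order\<close>

definition iter_integral :: "real \<Rightarrow> nat \<Rightarrow> (real \<Rightarrow> real) \<Rightarrow> real \<Rightarrow> real" where
  "iter_integral t\<^sub>0 q f t =
     1 / fact (q - 1) * (LINT u:{t\<^sub>0..t}|lborel. (t - u) ^ (q - 1) * f u)"

definition signed_op :: "real \<Rightarrow> real \<Rightarrow> int \<Rightarrow> (real \<Rightarrow> real) \<Rightarrow> real \<Rightarrow> real" where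
  "signed_op t\<^sub>0 t\<^sub>1 k f =
     (if k < 0 then (deriv_in {t\<^sub>0..t\<^sub>1} ^^ nat (- k)) f
      else if k = 0 then f
      else iter_integral t\<^sub>0 (nat k) f)"

definition boundary_poly :: "real \<Rightarrow> (nat \<Rightarrow> 'w \<Rightarrow> real) \<Rightarrow> nat \<Rightarrow> real \<Rightarrow> 'w \<Rightarrow> real" where
  "boundary_poly t\<^sub>0 \<kappa> p t \<omega> = (\<Sum>j=1..p. (t - t\<^sub>0) ^ (p - j) / fact (p - j) * \<kappa> j \<omega>)"

end

theory Submission imports Defs begin

text \<open>Everything is reduced to one fact about Gaussian variables: almost sure convergence within a
  Gaussian space already is convergence in mean square. For a normal variable \<open>Z\<close> the fourth moment is
  at most three times the squared second moment, so a second moment that stays away from \<open>0\<close> cannot hide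
  on events of vanishing probability. Starting from the span of the process, the closure under almost
  sure limits is again a linear space of normal variables. Difference quotients and Riemann sums of the
  smooth version converge path by path to path derivatives and path integrals; inside that closure
  these limits are mean-square limits, hence they are the mean-square derivatives and integrals.\<close>

section \<open>Normal laws\<close>

text \<open>\<open>ms_deriv\<close> and \<open>ms_integral\<close> choose a representative by
  \<open>SOME\<close>, so nothing is known about them until some mean-square limit is exhibited; the
  path limit is the candidate, and uniqueness up to null sets identifies the choice with it. Two
  obstacles shape the way there. A version agrees with the process only off a null set that depends
  on the time, so almost sure convergence is available along each sequence of arguments separately,
  not along the whole filter; hence the countable filter bases. Moreover \<open>M\<close> need not
  be complete, so an almost sure limit is not automatically measurable; measurability comes from
  limits that exist at every point of the space, which is why all paths are first made smooth.
  Working in a linear space of normal variables, rather than with one process, lets the derivative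
  step be repeated and yields the joint Gaussian law by the same argument once the boundary
  variables are added to the generators.\<close>

lemma normal_law_eq_distr_std:
  assumes "\<sigma> \<ge> 0"
  shows "normal_law m \<sigma> = distr std_normal_distribution borel (\<lambda>x. m + \<sigma> * x)"
proof (cases "\<sigma> = 0")
  case True
  interpret prob_space std_normal_distribution
    by (rule prob_space_normal_density) simp
  show ?thesis
    using True by (simp add: normal_law_def distr_const)
next
  case False
  interpret prob_space std_normal_distribution
    by (rule prob_space_normal_density) simp
  have "distributed std_normal_distribution lborel (\<lambda>x. x) std_normal_density"
    by (auto simp: distributed_def distr_id2)
  then have "distributed std_normal_distribution lborel (\<lambda>x. m + \<sigma> * x) (normal_density (m + \<sigma> * 0) (\<bar>\<sigma>\<bar> * 1))"
    using False by (intro normal_density_affine) auto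
  then have "distr std_normal_distribution lborel (\<lambda>x. m + \<sigma> * x) = density lborel (normal_density m \<sigma>)"
    using assms by (simp add: distributed_def)
  moreover have "distr std_normal_distribution lborel (\<lambda>x. m + \<sigma> * x)
      = distr std_normal_distribution borel (\<lambda>x. m + \<sigma> * x)"
    by (rule distr_cong) auto
  ultimately show ?thesis
    using False by (simp add: normal_law_def)
qed

lemma real_distribution_normal_law:
  assumes "\<sigma> \<ge> 0"
  shows "real_distribution (normal_law m \<sigma>)"
proof -
  interpret prob_space std_normal_distribution
    by (rule prob_space_normal_density) simp
  show ?thesis
    unfolding normal_law_eq_distr_std[OF assms] by (rule real_distribution_distr) simp
qed

lemma char_normal_law:
  assumes "\<sigma> \<ge> 0"
  shows "char (normal_law m \<sigma>) t = iexp (t * m) * exp (- ((t * \<sigma>)\<^sup>2) / 2)"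
proof -
  have "char (normal_law m \<sigma>) t = (CLINT x|std_normal_distribution. iexp (t * (m + \<sigma> * x)))"
    unfolding normal_law_eq_distr_std[OF assms] char_def by (subst integral_distr) auto
  also have "\<dots> = (CLINT x|std_normal_distribution. iexp (t * m) * iexp ((t * \<sigma>) * x))"
    by (intro Bochner_Integration.integral_cong) (auto simp: algebra_simps exp_add[symmetric])
  also have "\<dots> = iexp (t * m) * char std_normal_distribution (t * \<sigma>)"
    unfolding char_def by (rule integral_mult_right_zero)
  finally show ?thesis
    by (simp add: char_std_normal_distribution)
qed

lemma normal_rvE:
  assumes "normal_rv M X"
  obtains m \<sigma> where "\<sigma> \<ge> 0" "X \<in> borel_measurable M" "distr M borel X = normal_law m \<sigma>"
  using assms by (auto simp: normal_rv_def)

text \<open>All moments are computed for \<open>m + \<sigma> * x\<close> with \<open>x\<close>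
  standard normal, which treats the point mass \<open>\<sigma> = 0\<close> together with the proper
  densities.\<close>

lemma normal_law_moments:
  assumes X: "X \<in> borel_measurable M" "distr M borel X = normal_law m \<sigma>" "\<sigma> \<ge> 0"
  shows "integrable M (\<lambda>\<omega>. X \<omega> ^ n)"
    and "(\<integral>\<omega>. X \<omega> ^ 2 \<partial>M) = m\<^sup>2 + \<sigma>\<^sup>2"
    and "(\<integral>\<omega>. X \<omega> ^ 4 \<partial>M) = m ^ 4 + 6 * m\<^sup>2 * \<sigma>\<^sup>2 + 3 * \<sigma> ^ 4"
proof -
  let ?N = std_normal_distribution
  interpret N: prob_space ?N
    by (rule prob_space_normal_density) simp
  note [measurable] = X(1)
  have D: "distr M borel X = distr ?N borel (\<lambda>x. m + \<sigma> * x)"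
    using X normal_law_eq_distr_std by simp
  have N1: "N.prob UNIV = 1"
    using N.prob_space by simp
  have int: "integrable ?N (\<lambda>x. x ^ k)" for k
    by (rule integrable_std_normal_distribution_moment)
  have int1 [simp]: "integrable ?N (\<lambda>x. x)"
    using int[of 1] by simp
  have E: "(\<integral>\<omega>. X \<omega> ^ k \<partial>M) = (\<integral>x. (m + \<sigma> * x) ^ k \<partial>?N)" for k
  proof -
    have "(\<integral>\<omega>. X \<omega> ^ k \<partial>M) = (\<integral>x. x ^ k \<partial>distr M borel X)"
      by (subst integral_distr) auto
    then show ?thesis
      unfolding D by (subst (asm) integral_distr) auto
  qed
  have "integrable ?N (\<lambda>x. (m + \<sigma> * x) ^ k)" for k
    unfolding binomial_ring by (auto simp: power_mult_distrib intro!: int)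
  then have "integrable (distr M borel X) (\<lambda>x. x ^ n)"
    unfolding D by (subst integrable_distr_eq) auto
  then show "integrable M (\<lambda>\<omega>. X \<omega> ^ n)"
    by (subst (asm) integrable_distr_eq) auto
  have m1: "(\<integral>x. x \<partial>?N) = 0"
    using integral_std_normal_distribution_moment_odd[of 1] by simp
  have m2: "(\<integral>x. x\<^sup>2 \<partial>?N) = 1"
    using std_normal_distribution_even_moments(1)[of 1] by (simp add: fact_numeral)
  have m3: "(\<integral>x. x ^ 3 \<partial>?N) = 0"
    using integral_std_normal_distribution_moment_odd[of 3] by simp
  have m4: "(\<integral>x. x ^ 4 \<partial>?N) = 3"
    using std_normal_distribution_even_moments(1)[of 2] by (simp add: fact_numeral)
  have "(\<integral>x. (m + \<sigma> * x)\<^sup>2 \<partial>?N) = (\<integral>x. m\<^sup>2 + (2 * m * \<sigma>) * x + \<sigma>\<^sup>2 * x\<^sup>2 \<partial>?N)"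
    by (intro Bochner_Integration.integral_cong) (auto simp: power2_eq_square algebra_simps)
  then show "(\<integral>\<omega>. X \<omega> ^ 2 \<partial>M) = m\<^sup>2 + \<sigma>\<^sup>2"
    unfolding E using int by (simp add: m1 m2 N1)
  have "(\<integral>x. (m + \<sigma> * x)^4 \<partial>?N) = (\<integral>x. m^4 + (4 * m^3 * \<sigma>) * x + (6 * m\<^sup>2 * \<sigma>\<^sup>2) * x\<^sup>2
      + (4 * m * \<sigma>^3) * x^3 + \<sigma>^4 * x^4 \<partial>?N)"
    by (intro Bochner_Integration.integral_cong) (auto simp: eval_nat_numeral algebra_simps)
  then show "(\<integral>\<omega>. X \<omega> ^ 4 \<partial>M) = m ^ 4 + 6 * m\<^sup>2 * \<sigma>\<^sup>2 + 3 * \<sigma> ^ 4"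
    unfolding E using int by (simp add: m1 m2 m3 m4 N1)
qed

lemma normal_rv_square_integrable: "normal_rv M X \<Longrightarrow> square_integrable M X"
  by (auto elim!: normal_rvE simp: square_integrable_def intro: normal_law_moments)

section \<open>Second moments of normal variables and almost sure limits\<close>

text \<open>The right side exceeds the left by \<open>2 * m ^ 4\<close>: the constant 3 is that of
  the centred law, and a nonzero mean only adds slack.\<close>

lemma normal_rv_fourth_moment:
  assumes "normal_rv M X"
  shows "(\<integral>\<omega>. X \<omega> ^ 4 \<partial>M) \<le> 3 * (\<integral>\<omega>. (X \<omega>)\<^sup>2 \<partial>M)\<^sup>2"
proof -
  obtain m \<sigma> where X: "\<sigma> \<ge> 0" "X \<in> borel_measurable M" "distr M borel X = normal_law m \<sigma>"
    using assms by (rule normal_rvE)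
  have "3 * (m\<^sup>2 + \<sigma>\<^sup>2)\<^sup>2 = (m ^ 4 + 6 * m\<^sup>2 * \<sigma>\<^sup>2 + 3 * \<sigma> ^ 4) + 2 * m ^ 4"
    by (simp add: eval_nat_numeral algebra_simps)
  then show ?thesis
    by (simp add: normal_law_moments[OF X(2,3,1)])
qed

text \<open>By the fourth moment bound, an event of probability at most \<open>1 / 12\<close> carries at most half of the
  second moment.\<close>

lemma (in prob_space) normal_rv_second_moment_le:
  assumes X: "normal_rv M X" and c: "c \<ge> 0"
    and P: "prob {\<omega> \<in> space M. (X \<omega>)\<^sup>2 > c} \<le> 1 / 12"
  shows "expectation (\<lambda>\<omega>. (X \<omega>)\<^sup>2) \<le> 2 * c"
proof -
  define s where "s = expectation (\<lambda>\<omega>. (X \<omega>)\<^sup>2)"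
  have [measurable]: "X \<in> borel_measurable M" and i2: "integrable M (\<lambda>\<omega>. (X \<omega>)\<^sup>2)"
    and i4: "integrable M (\<lambda>\<omega>. X \<omega> ^ 4)"
    using X by (auto elim!: normal_rvE intro: normal_law_moments)
  have s0: "s \<ge> 0"
    by (simp add: s_def)
  let ?A = "{\<omega> \<in> space M. (X \<omega>)\<^sup>2 > c}"
  show ?thesis
  proof (cases "s = 0")
    case True
    then show ?thesis using c by (simp add: s_def)
  next
    case False
    with s0 have s: "s > 0" by simp
    \<comment> \<open>Off \<open>?A\<close> the bound is \<open>c\<close>; on \<open>?A\<close> it
      is the inequality of means with weight \<open>6 * s\<close>. The weight and the threshold 1/12
      are matched: after integration the fourth moment and \<open>prob ?A\<close> contribute at most
      \<open>s / 4\<close> each, and their sum \<open>s / 2\<close> is absorbed on the left.\<close>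
    have pt: "(X \<omega>)\<^sup>2 \<le> c + (X \<omega> ^ 4 / (12 * s) + 3 * s * indicator ?A \<omega>)" if "\<omega> \<in> space M" for \<omega>
    proof (cases "\<omega> \<in> ?A")
      case True
      have "0 \<le> ((X \<omega>)\<^sup>2 - 6 * s)\<^sup>2" by simp
      then have "12 * s * (X \<omega>)\<^sup>2 \<le> X \<omega> ^ 4 + 36 * s\<^sup>2"
        by (simp add: eval_nat_numeral algebra_simps)
      then have "(X \<omega>)\<^sup>2 \<le> X \<omega> ^ 4 / (12 * s) + 3 * s"
        using s by (simp add: field_simps power2_eq_square)
      then show ?thesis using True c by simp
    next
      case False
      then have "(X \<omega>)\<^sup>2 \<le> c" using that by auto
      moreover have "X \<omega> ^ 4 / (12 * s) \<ge> 0" using s by simp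
      ultimately show ?thesis using False by simp
    qed
    have "s \<le> expectation (\<lambda>\<omega>. c + (X \<omega> ^ 4 / (12 * s) + 3 * s * indicator ?A \<omega>))"
      unfolding s_def
    proof (rule integral_mono[OF i2])
      show "integrable M (\<lambda>\<omega>. c + (X \<omega> ^ 4 / (12 * expectation (\<lambda>\<omega>. (X \<omega>)\<^sup>2))
          + 3 * expectation (\<lambda>\<omega>. (X \<omega>)\<^sup>2) * indicator ?A \<omega>))"
        by (intro Bochner_Integration.integrable_add integrable_const integrable_divide
            integrable_mult_right integrable_real_indicator i4) (auto simp: emeasure_finite less_top[symmetric])
    qed (use pt in \<open>simp add: s_def\<close>)
    also have "\<dots> = c + (expectation (\<lambda>\<omega>. X \<omega> ^ 4) / (12 * s) + 3 * s * prob ?A)"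
      using i4 integrable_real_indicator[of ?A M] by (simp add: prob_space emeasure_finite less_top[symmetric])
    also have "\<dots> \<le> c + (3 * s\<^sup>2 / (12 * s) + 3 * s * (1 / 12))"
      using normal_rv_fourth_moment[OF X] P s
      by (intro add_left_mono add_mono divide_right_mono mult_left_mono) (auto simp: s_def)
    also have "\<dots> = c + s / 2"
      using s by (simp add: power2_eq_square)
    finally show ?thesis by (simp add: s_def)
  qed
qed

text \<open>Almost sure convergence makes the probability that the square exceeds
  \<open>e / 3\<close> fall below 1/12 eventually; from then on the preceding bound gives
  \<open>2 * e / 3\<close>, strictly below \<open>e\<close>.\<close>

lemma (in prob_space) normal_rv_AE_null_imp_L2_null:
  assumes X: "\<And>n. normal_rv M (X n)" and lim: "AE \<omega> in M. (\<lambda>n. X n \<omega>) \<longlonglongrightarrow> 0"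
  shows "(\<lambda>n. expectation (\<lambda>\<omega>. (X n \<omega>)\<^sup>2)) \<longlonglongrightarrow> 0"
proof (rule LIMSEQ_I)
  fix e :: real assume e: "e > 0"
  let ?A = "\<lambda>n. {\<omega> \<in> space M. (X n \<omega>)\<^sup>2 > e / 3}"
  have [measurable]: "X n \<in> borel_measurable M" for n
    using X by (auto elim!: normal_rvE)
  have "(\<lambda>n. expectation (indicator (?A n))) \<longlonglongrightarrow> expectation (\<lambda>\<omega>. 0 :: real)"
  proof (rule integral_dominated_convergence[where w = "\<lambda>_. 1"])
    show "AE \<omega> in M. (\<lambda>n. indicator (?A n) \<omega>) \<longlonglongrightarrow> (0 :: real)"
      using lim
    proof eventually_elim
      case (elim \<omega>)
      have "(\<lambda>n. (X n \<omega>)\<^sup>2) \<longlonglongrightarrow> 0\<^sup>2"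
        using elim by (rule tendsto_power)
      then have "\<forall>\<^sub>F n in sequentially. (X n \<omega>)\<^sup>2 < e / 3"
        using e by (intro order_tendstoD(2)[of _ "0\<^sup>2"]) auto
      then have "\<forall>\<^sub>F n in sequentially. indicator (?A n) \<omega> = (0 :: real)"
        by (rule eventually_mono) (auto simp: indicator_def)
      then show ?case by (rule tendsto_eventually)
    qed
  qed (auto simp: indicator_def)
  then have "(\<lambda>n. prob (?A n)) \<longlonglongrightarrow> 0"
    by simp
  then have "\<forall>\<^sub>F n in sequentially. prob (?A n) < 1 / 12"
    by (rule order_tendstoD(2)) simp
  then obtain N where N: "\<And>n. n \<ge> N \<Longrightarrow> prob (?A n) < 1 / 12"
    by (auto simp: eventually_sequentially)
  show "\<exists>N. \<forall>n\<ge>N. norm (expectation (\<lambda>\<omega>. (X n \<omega>)\<^sup>2) - 0) < e"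
  proof (intro exI allI impI)
    fix n assume "n \<ge> N"
    then have "expectation (\<lambda>\<omega>. (X n \<omega>)\<^sup>2) \<le> 2 * (e / 3)"
      using N[of n] e X by (intro normal_rv_second_moment_le) auto
    then show "norm (expectation (\<lambda>\<omega>. (X n \<omega>)\<^sup>2) - 0) < e"
      using e by simp
  qed
qed

text \<open>The parameters of the approximating laws are not assumed bounded. Almost every sequence
  of values is bounded, so one constant works for all \<open>n\<close> off an event of probability
  below 1/12; this bounds the second moments, hence the parameters, and along a convergent
  subsequence of them the characteristic functions identify the limit law.\<close>

lemma (in prob_space) normal_rv_AE_limit:
  assumes X: "\<And>n. normal_rv M (X n)" and Y [measurable]: "Y \<in> borel_measurable M"
    and lim: "AE \<omega> in M. (\<lambda>n. X n \<omega>) \<longlonglongrightarrow> Y \<omega>"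
  shows "normal_rv M Y"
proof -
  have [measurable]: "X n \<in> borel_measurable M" for n
    using X by (auto elim!: normal_rvE)
  \<comment> \<open>The quantifier over \<open>n\<close> sits inside the event, so that a single
    \<open>K\<close> serves the whole sequence.\<close>
  let ?B = "\<lambda>K. {\<omega> \<in> space M. \<exists>n. \<bar>X n \<omega>\<bar> > real K}"
  have "(\<lambda>K. prob (?B K)) \<longlonglongrightarrow> prob (\<Inter>K. ?B K)"
    by (rule finite_Lim_measure_decseq) (auto simp: decseq_def, meson le_less_trans of_nat_le_iff)
  moreover have "prob (\<Inter>K. ?B K) = 0"
  proof -
    have "AE \<omega> in M. \<omega> \<notin> (\<Inter>K. ?B K)"
      using lim
    proof eventually_elim
      case (elim \<omega>)
      then have "Bseq (\<lambda>n. X n \<omega>)"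
        by (intro convergent_imp_Bseq convergentI)
      then obtain K where "\<And>n. \<bar>X n \<omega>\<bar> \<le> K"
        by (auto simp: Bseq_def)
      moreover obtain k :: nat where "K \<le> real k"
        using real_arch_simple by blast
      ultimately have "\<omega> \<notin> ?B k"
        by (auto simp: not_less intro: order_trans)
      then show ?case by blast
    qed
    then show ?thesis
      by (subst prob_eq_0) auto
  qed
  ultimately have "\<forall>\<^sub>F K in sequentially. prob (?B K) < 1 / 12"
    by (intro order_tendstoD(2)[of _ 0]) auto
  then obtain K where K: "prob (?B K) < 1 / 12"
    by (auto simp: eventually_sequentially)
  have bd: "expectation (\<lambda>\<omega>. (X n \<omega>)\<^sup>2) \<le> 2 * (real K)\<^sup>2" for n
  proof (rule normal_rv_second_moment_le[OF X])
    have "prob {\<omega> \<in> space M. (X n \<omega>)\<^sup>2 > (real K)\<^sup>2} \<le> prob (?B K)"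
    proof (intro finite_measure_mono subsetI)
      fix \<omega> assume \<omega>: "\<omega> \<in> {\<omega> \<in> space M. (X n \<omega>)\<^sup>2 > (real K)\<^sup>2}"
      then have "\<not> \<bar>X n \<omega>\<bar> \<le> real K"
        using power_mono[of "\<bar>X n \<omega>\<bar>" "real K" 2] by auto
      then show "\<omega> \<in> ?B K"
        using \<omega> by (auto simp: not_le)
    qed simp
    then show "prob {\<omega> \<in> space M. (X n \<omega>)\<^sup>2 > (real K)\<^sup>2} \<le> 1 / 12"
      using K by simp
  qed simp
  have "\<exists>m \<sigma>. \<sigma> \<ge> 0 \<and> distr M borel (X n) = normal_law m \<sigma>" for n
    using X[of n] by (auto simp: normal_rv_def)
  then obtain m \<sigma> where \<sigma>: "\<And>n. \<sigma> n \<ge> 0" and d: "\<And>n. distr M borel (X n) = normal_law (m n) (\<sigma> n)"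
    by metis
  define R where "R = sqrt (2 * (real K)\<^sup>2)"
  have "(m n)\<^sup>2 + (\<sigma> n)\<^sup>2 \<le> R\<^sup>2" for n
    using bd[of n] normal_law_moments(2)[OF _ d \<sigma>, of n] by (simp add: R_def)
  then have "(m n, \<sigma> n) \<in> cball 0 R" for n
    by (auto simp: norm_Pair real_le_lsqrt R_def)
  moreover have "compact (cball (0 :: real \<times> real) R)"
    by simp
  ultimately obtain l q where q: "strict_mono q" and l: "((\<lambda>n. (m n, \<sigma> n)) \<circ> q) \<longlonglongrightarrow> l"
    unfolding compact_def by (elim allE[of _ "\<lambda>n. (m n, \<sigma> n)"]) blast
  have lm: "(\<lambda>n. m (q n)) \<longlonglongrightarrow> fst l" and ls: "(\<lambda>n. \<sigma> (q n)) \<longlonglongrightarrow> snd l"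
    using tendsto_fst[OF l] tendsto_snd[OF l] by (auto simp: o_def)
  \<comment> \<open>The limit may be 0 although all \<open>\<sigma> n\<close> are positive; this is
    where point masses have to count as normal laws.\<close>
  have s0: "snd l \<ge> 0"
    using ls \<sigma> by (intro LIMSEQ_le_const) auto
  have "char (distr M borel Y) t = char (normal_law (fst l) (snd l)) t" for t
  proof (rule LIMSEQ_unique)
    have "(\<lambda>n. expectation (\<lambda>\<omega>. iexp (t * X (q n) \<omega>))) \<longlonglongrightarrow> expectation (\<lambda>\<omega>. iexp (t * Y \<omega>))"
    proof (rule integral_dominated_convergence[where w = "\<lambda>_. 1"])
      show "AE \<omega> in M. (\<lambda>n. iexp (t * X (q n) \<omega>)) \<longlonglongrightarrow> iexp (t * Y \<omega>)"
        using lim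
      proof eventually_elim
        case (elim \<omega>)
        have "(\<lambda>n. X (q n) \<omega>) \<longlonglongrightarrow> Y \<omega>"
          using LIMSEQ_subseq_LIMSEQ[OF elim q] by (simp add: o_def)
        then show ?case by (intro tendsto_intros)
      qed
    qed auto
    then show "(\<lambda>n. char (distr M borel (X (q n))) t) \<longlonglongrightarrow> char (distr M borel Y) t"
      unfolding char_def by (simp add: integral_distr)
    show "(\<lambda>n. char (distr M borel (X (q n))) t) \<longlonglongrightarrow> char (normal_law (fst l) (snd l)) t"
      unfolding d char_normal_law[OF \<sigma>] char_normal_law[OF s0] using lm ls by (intro tendsto_intros) auto
  qed
  then have "distr M borel Y = normal_law (fst l) (snd l)"
    using s0 by (intro Levy_uniqueness real_distribution_distr real_distribution_normal_law) auto
  then show ?thesis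
    using s0 by (auto simp: normal_rv_def)
qed

text \<open>Characteristic functions are multiplied instead of convolving densities, because either
  summand may be degenerate.\<close>

lemma (in prob_space) normal_rv_indep_add:
  assumes X: "normal_rv M X" and Y: "normal_rv M Y" and ind: "indep_var borel X borel Y"
  shows "normal_rv M (\<lambda>\<omega>. X \<omega> + Y \<omega>)"
proof -
  obtain m \<sigma> where \<sigma>: "\<sigma> \<ge> 0" and [measurable]: "X \<in> borel_measurable M" and dX: "distr M borel X = normal_law m \<sigma>"
    using X by (rule normal_rvE)
  obtain m' \<sigma>' where \<sigma>': "\<sigma>' \<ge> 0" and [measurable]: "Y \<in> borel_measurable M" and dY: "distr M borel Y = normal_law m' \<sigma>'"
    using Y by (rule normal_rvE)
  have "char (distr M borel (\<lambda>\<omega>. X \<omega> + Y \<omega>)) t = char (normal_law (m + m') (sqrt (\<sigma>\<^sup>2 + \<sigma>'\<^sup>2))) t" for t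
  proof -
    have e: "exp (- ((t * \<sigma>)\<^sup>2) / 2) * exp (- ((t * \<sigma>')\<^sup>2) / 2) = exp (- ((t * sqrt (\<sigma>\<^sup>2 + \<sigma>'\<^sup>2))\<^sup>2) / 2)"
      unfolding exp_add[symmetric] by (simp add: power_mult_distrib add_divide_distrib distrib_left)
    have i: "iexp (t * m) * iexp (t * m') = iexp (t * (m + m'))"
      unfolding exp_add[symmetric] by (simp add: distrib_left)
    show ?thesis
      unfolding char_distr_add[OF ind] dX dY char_normal_law[OF \<sigma>] char_normal_law[OF \<sigma>']
        char_normal_law[OF real_sqrt_ge_zero[OF sum_power2_ge_zero]] i[symmetric] e[symmetric]
      unfolding of_real_mult
      by (simp only: mult_ac)
  qed
  then have "distr M borel (\<lambda>\<omega>. X \<omega> + Y \<omega>) = normal_law (m + m') (sqrt (\<sigma>\<^sup>2 + \<sigma>'\<^sup>2))"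
    by (intro Levy_uniqueness real_distribution_distr real_distribution_normal_law) auto
  then show ?thesis
    unfolding normal_rv_def
    by (intro conjI exI[of _ "m + m'"] exI[of _ "sqrt (\<sigma>\<^sup>2 + \<sigma>'\<^sup>2)"]) auto
qed

section \<open>Gaussian spaces\<close>

lemma square_integrable_diff:
  assumes "square_integrable M X" "square_integrable M Y"
  shows "square_integrable M (\<lambda>\<omega>. X \<omega> - Y \<omega>)"
  unfolding square_integrable_def
proof
  have [measurable]: "X \<in> borel_measurable M" "Y \<in> borel_measurable M"
    using assms by (auto simp: square_integrable_def)
  show "(\<lambda>\<omega>. X \<omega> - Y \<omega>) \<in> borel_measurable M" by simp
  have sq: "(x - y)\<^sup>2 \<le> 2 * x\<^sup>2 + 2 * y\<^sup>2" for x y :: real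
    using zero_le_power2[of "x + y"] by (simp add: power2_eq_square algebra_simps)
  show "integrable M (\<lambda>\<omega>. (X \<omega> - Y \<omega>)\<^sup>2)"
  proof (rule Bochner_Integration.integrable_bound)
    show "integrable M (\<lambda>\<omega>. 2 * (X \<omega>)\<^sup>2 + 2 * (Y \<omega>)\<^sup>2)"
      using assms by (auto simp: square_integrable_def)
  qed (auto intro!: AE_I2 order_trans[OF sq])
qed

text \<open>The elementary bound for \<open>(y - z)\<^sup>2\<close> replaces the triangle inequality
  of a norm. This is the tool that turns a representative chosen by \<open>SOME\<close> into a
  computed limit.\<close>

lemma L2_tendsto_unique:
  assumes Y: "L2_tendsto M X Y F" and Z: "L2_tendsto M X Z F" and F: "F \<noteq> bot"
  shows "AE \<omega> in M. Y \<omega> = Z \<omega>"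
proof -
  have sqY: "square_integrable M Y" and sqZ: "square_integrable M Z"
    and sqX: "\<forall>\<^sub>F a in F. square_integrable M (X a)"
    using Y Z by (auto simp: L2_tendsto_def)
  have "0 \<le> (\<integral>\<omega>. (Y \<omega> - Z \<omega>)\<^sup>2 \<partial>M)"
    by simp
  moreover have "(\<integral>\<omega>. (Y \<omega> - Z \<omega>)\<^sup>2 \<partial>M) \<le> 2 * 0 + 2 * 0"
  proof (rule tendsto_lowerbound[OF _ _ F])
    show "((\<lambda>a. 2 * (\<integral>\<omega>. (X a \<omega> - Y \<omega>)\<^sup>2 \<partial>M) + 2 * (\<integral>\<omega>. (X a \<omega> - Z \<omega>)\<^sup>2 \<partial>M)) \<longlongrightarrow> 2 * 0 + 2 * 0) F"
      using Y Z unfolding L2_tendsto_def by (intro tendsto_intros) auto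
    show "\<forall>\<^sub>F a in F. (\<integral>\<omega>. (Y \<omega> - Z \<omega>)\<^sup>2 \<partial>M)
        \<le> 2 * (\<integral>\<omega>. (X a \<omega> - Y \<omega>)\<^sup>2 \<partial>M) + 2 * (\<integral>\<omega>. (X a \<omega> - Z \<omega>)\<^sup>2 \<partial>M)"
      using sqX
    proof eventually_elim
      case (elim a)
      have i: "integrable M (\<lambda>\<omega>. (X a \<omega> - Y \<omega>)\<^sup>2)" "integrable M (\<lambda>\<omega>. (X a \<omega> - Z \<omega>)\<^sup>2)"
        "integrable M (\<lambda>\<omega>. (Y \<omega> - Z \<omega>)\<^sup>2)"
        using square_integrable_diff[OF elim sqY] square_integrable_diff[OF elim sqZ]
          square_integrable_diff[OF sqY sqZ] by (auto simp: square_integrable_def)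
      have sq: "(y - z)\<^sup>2 \<le> 2 * (x - y)\<^sup>2 + 2 * (x - z)\<^sup>2" for x y z :: real
        using zero_le_power2[of "(x - y) + (x - z)"] by (simp add: power2_eq_square algebra_simps)
      have "(\<integral>\<omega>. (Y \<omega> - Z \<omega>)\<^sup>2 \<partial>M) \<le> (\<integral>\<omega>. 2 * (X a \<omega> - Y \<omega>)\<^sup>2 + 2 * (X a \<omega> - Z \<omega>)\<^sup>2 \<partial>M)"
        using i by (intro integral_mono sq) auto
      then show ?case
        using i by simp
    qed
  qed
  ultimately have "(\<integral>\<omega>. (Y \<omega> - Z \<omega>)\<^sup>2 \<partial>M) = 0"
    by linarith
  then show ?thesis
    using square_integrable_diff[OF sqY sqZ]
    by (subst (asm) integral_nonneg_eq_0_iff_AE) (auto simp: square_integrable_def)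
qed

text \<open>The inductive form makes limits of limits members by construction, without a diagonal
  argument. Measurability of \<open>Y\<close> is a separate premise because over an incomplete
  measure space an almost sure limit can fail to be measurable.\<close>

inductive_set ae_closure :: "'w measure \<Rightarrow> ('w \<Rightarrow> real) set \<Rightarrow> ('w \<Rightarrow> real) set"
  for M :: "'w measure" and V :: "('w \<Rightarrow> real) set" where
  base: "X \<in> V \<Longrightarrow> X \<in> ae_closure M V"
| limit: "(\<And>n::nat. X n \<in> ae_closure M V) \<Longrightarrow> Y \<in> borel_measurable M \<Longrightarrow>
    AE \<omega> in M. (\<lambda>n. X n \<omega>) \<longlonglongrightarrow> Y \<omega> \<Longrightarrow> Y \<in> ae_closure M V"

definition gaussian_hull :: "'w measure \<Rightarrow> 'i set \<Rightarrow> ('i \<Rightarrow> 'w \<Rightarrow> real) \<Rightarrow> ('w \<Rightarrow> real) set" where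
  "gaussian_hull M T X = ae_closure M {\<lambda>\<omega>. \<Sum>i\<in>S. a i * X i \<omega> | S a. finite S \<and> S \<subseteq> T}"

locale gaussian_family = prob_space M for M :: "'w measure" +
  fixes T :: "'i set" and X :: "'i \<Rightarrow> 'w \<Rightarrow> real"
  assumes jointly_gaussian: "jointly_gaussian M T X"
begin

abbreviation \<H> :: "('w \<Rightarrow> real) set" where
  "\<H> \<equiv> gaussian_hull M T X"

lemma hull_normal_rv: "Y \<in> \<H> \<Longrightarrow> normal_rv M Y"
  unfolding gaussian_hull_def
proof (induction rule: ae_closure.induct)
  case (base Y)
  then show ?case using jointly_gaussian by (auto simp: jointly_gaussian_def)
next
  case (limit Z Y)
  then show ?case by (intro normal_rv_AE_limit[of Z Y]) auto
qed

lemma hull_measurable: "Y \<in> \<H> \<Longrightarrow> Y \<in> borel_measurable M"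
  using hull_normal_rv by (auto simp: normal_rv_def)

lemma hull_limit:
  "(\<And>n. Z n \<in> \<H>) \<Longrightarrow> Y \<in> borel_measurable M \<Longrightarrow> AE \<omega> in M. (\<lambda>n. Z n \<omega>) \<longlonglongrightarrow> Y \<omega> \<Longrightarrow> Y \<in> \<H>"
  unfolding gaussian_hull_def by (rule ae_closure.limit)

lemma hull_AE_eq:
  "Z \<in> \<H> \<Longrightarrow> Y \<in> borel_measurable M \<Longrightarrow> AE \<omega> in M. Z \<omega> = Y \<omega> \<Longrightarrow> Y \<in> \<H>"
  by (rule hull_limit[of "\<lambda>_. Z"]) auto

lemma hull_base:
  assumes "i \<in> T"
  shows "X i \<in> \<H>"
  unfolding gaussian_hull_def using assms
  by (intro ae_closure.base) (auto intro!: exI[of _ "{i}"] exI[of _ "\<lambda>_. 1"])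

lemma hull_zero: "(\<lambda>\<omega>. 0) \<in> \<H>"
  unfolding gaussian_hull_def
  by (intro ae_closure.base) (auto intro!: exI[of _ "{}"])

lemma hull_scale: "Y \<in> \<H> \<Longrightarrow> (\<lambda>\<omega>. c * Y \<omega>) \<in> \<H>"
proof -
  assume "Y \<in> \<H>"
  then have "Y \<in> ae_closure M {\<lambda>\<omega>. \<Sum>i\<in>S. a i * X i \<omega> | S a. finite S \<and> S \<subseteq> T}"
    by (simp add: gaussian_hull_def)
  then show ?thesis
  proof (induction rule: ae_closure.induct)
    case (base Y)
    then obtain S a where "Y = (\<lambda>\<omega>. \<Sum>i\<in>S. a i * X i \<omega>)" "finite S" "S \<subseteq> T"
      by auto
    then show ?case
      unfolding gaussian_hull_def
      by (intro ae_closure.base)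
        (auto intro!: exI[of _ S] exI[of _ "\<lambda>i. c * a i"] simp: sum_distrib_left mult.assoc)
  next
    case (limit Z Y)
    note [measurable] = limit.hyps(2)
    show ?case
    proof (rule hull_limit[of "\<lambda>n \<omega>. c * Z n \<omega>"])
      show "AE \<omega> in M. (\<lambda>n. c * Z n \<omega>) \<longlonglongrightarrow> c * Y \<omega>"
        using limit.hyps(3) by eventually_elim (intro tendsto_intros)
    qed (use limit in auto)
  qed
qed

text \<open>Additivity is the usual two-step hull argument: the elements whose sum with a fixed one stays
  in the hull are closed under limits; the fixed one is first taken in the span, then in the hull.\<close>

lemma hull_add:
  assumes Y: "Y \<in> \<H>" and Z: "Z \<in> \<H>"
  shows "(\<lambda>\<omega>. Y \<omega> + Z \<omega>) \<in> \<H>"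
proof -
  let ?V = "{\<lambda>\<omega>. \<Sum>i\<in>S. a i * X i \<omega> | S a. finite S \<and> S \<subseteq> T}"
  have span_add: "(\<lambda>\<omega>. U \<omega> + U' \<omega>) \<in> \<H>" if U: "U \<in> ?V" and U': "U' \<in> ?V" for U U'
  proof -
    obtain S a where S: "U = (\<lambda>\<omega>. \<Sum>i\<in>S. a i * X i \<omega>)" "finite S" "S \<subseteq> T"
      using U by auto
    obtain S' a' where S': "U' = (\<lambda>\<omega>. \<Sum>i\<in>S'. a' i * X i \<omega>)" "finite S'" "S' \<subseteq> T"
      using U' by auto
    define b where "b i = (if i \<in> S then a i else 0) + (if i \<in> S' then a' i else 0)" for i
    have "U \<omega> + U' \<omega> = (\<Sum>i\<in>S \<union> S'. b i * X i \<omega>)" for \<omega>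
    proof -
      have "U \<omega> = (\<Sum>i\<in>S \<union> S'. (if i \<in> S then a i else 0) * X i \<omega>)"
        unfolding S(1) using S S' by (intro sum.mono_neutral_cong_left) auto
      moreover have "U' \<omega> = (\<Sum>i\<in>S \<union> S'. (if i \<in> S' then a' i else 0) * X i \<omega>)"
        unfolding S'(1) using S S' by (intro sum.mono_neutral_cong_left) auto
      ultimately show ?thesis
        by (simp only: b_def distrib_right sum.distrib)
    qed
    then show ?thesis
      unfolding gaussian_hull_def using S S'
      by (intro ae_closure.base CollectI exI[of _ "S \<union> S'"] exI[of _ b]) auto
  qed
  have add_lim: "(\<lambda>\<omega>. U \<omega> + Y \<omega>) \<in> \<H>"
    if U: "U \<in> \<H>" and Y: "Y \<in> borel_measurable M" and lim: "AE \<omega> in M. (\<lambda>n. W n \<omega>) \<longlonglongrightarrow> Y \<omega>"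
      and W: "\<And>n. (\<lambda>\<omega>. U \<omega> + W n \<omega>) \<in> \<H>" for U W Y
  proof (rule hull_limit[of "\<lambda>n \<omega>. U \<omega> + W n \<omega>"])
    note [measurable] = Y hull_measurable[OF U]
    show "(\<lambda>\<omega>. U \<omega> + Y \<omega>) \<in> borel_measurable M" by simp
    show "AE \<omega> in M. (\<lambda>n. U \<omega> + W n \<omega>) \<longlonglongrightarrow> U \<omega> + Y \<omega>"
      using lim by eventually_elim (intro tendsto_intros)
  qed (use W in auto)
  have span_hull: "(\<lambda>\<omega>. U \<omega> + Z \<omega>) \<in> \<H>" if U: "U \<in> ?V" and Z: "Z \<in> \<H>" for U Z
    using Z unfolding gaussian_hull_def
  proof (induction rule: ae_closure.induct)
    case (base Z)
    then show ?case using span_add[OF U] by (simp add: gaussian_hull_def)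
  next
    case (limit W Y)
    show ?case
      using add_lim[of U Y W] U limit by (auto simp: gaussian_hull_def intro: ae_closure.base)
  qed
  show ?thesis
    using Y unfolding gaussian_hull_def
  proof (induction rule: ae_closure.induct)
    case (base U)
    then show ?case using span_hull[OF _ Z] by (simp add: gaussian_hull_def)
  next
    case (limit W Y)
    show ?case
      using add_lim[of Z Y W] Z limit by (auto simp: gaussian_hull_def add.commute)
  qed
qed

lemma hull_diff: "Y \<in> \<H> \<Longrightarrow> Z \<in> \<H> \<Longrightarrow> (\<lambda>\<omega>. Y \<omega> - Z \<omega>) \<in> \<H>"
  using hull_add[of Y "\<lambda>\<omega>. - 1 * Z \<omega>"] hull_scale[of Z "- 1"] by simp

lemma hull_sum: "(\<And>i. i \<in> S \<Longrightarrow> Y i \<in> \<H>) \<Longrightarrow> (\<lambda>\<omega>. \<Sum>i\<in>S. Y i \<omega>) \<in> \<H>"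
  by (induction S rule: infinite_finite_induct) (auto simp: hull_zero hull_add)

lemma hull_jointly_gaussian:
  assumes "\<And>i. i \<in> S \<Longrightarrow> Y i \<in> \<H>"
  shows "jointly_gaussian M S Y"
  unfolding jointly_gaussian_def using assms
  by (auto intro!: hull_normal_rv hull_sum hull_scale)

text \<open>The null set behind \<open>lim\<close> may change with the sequence \<open>s\<close>,
  and uncountably many sequences need not share one. Second moments, however, are numbers: if they
  did not converge along \<open>F\<close>, the countable base \<open>A\<close> would supply one
  sequence along which they stay away from 0, and for that sequence almost sure convergence inside
  the hull is a contradiction.\<close>

lemma hull_L2_tendsto:
  assumes F: "\<And>P. eventually P F \<longleftrightarrow> (\<exists>n::nat. \<forall>a\<in>A n. P a)"
    and A: "\<And>n. A n \<noteq> {}" "decseq A"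
    and Z: "\<And>a. a \<in> A 0 \<Longrightarrow> Z a \<in> \<H>" and Y: "Y \<in> borel_measurable M"
    and lim: "\<And>s. (\<And>n. s n \<in> A n) \<Longrightarrow> AE \<omega> in M. (\<lambda>n. Z (s n) \<omega>) \<longlonglongrightarrow> Y \<omega>"
  shows "L2_tendsto M Z Y F" and "Y \<in> \<H>"
proof -
  have A0: "a \<in> A n \<Longrightarrow> a \<in> A 0" for a n
    using A(2) by (auto simp: decseq_def)
  obtain s where s: "\<And>n. s n \<in> A n"
    using choice[of "\<lambda>n s. s \<in> A n"] A(1) by blast
  show Yh: "Y \<in> \<H>"
    using Z[OF A0[OF s]] Y lim[OF s] by (rule hull_limit)
  have "((\<lambda>a. \<integral>\<omega>. (Z a \<omega> - Y \<omega>)\<^sup>2 \<partial>M) \<longlongrightarrow> 0) F"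
  proof (rule ccontr)
    assume "\<not> ?thesis"
    then obtain e where e: "e > 0" "\<not> (\<forall>\<^sub>F a in F. dist (\<integral>\<omega>. (Z a \<omega> - Y \<omega>)\<^sup>2 \<partial>M) 0 < e)"
      by (auto simp: tendsto_iff)
    then obtain s where s: "\<And>n. s n \<in> A n"
      and far: "\<And>n. \<not> dist (\<integral>\<omega>. (Z (s n) \<omega> - Y \<omega>)\<^sup>2 \<partial>M) 0 < e"
      unfolding F by metis
    have "(\<lambda>n. expectation (\<lambda>\<omega>. (Z (s n) \<omega> - Y \<omega>)\<^sup>2)) \<longlonglongrightarrow> 0"
    proof (rule normal_rv_AE_null_imp_L2_null)
      show "normal_rv M (\<lambda>\<omega>. Z (s n) \<omega> - Y \<omega>)" for n
        by (intro hull_normal_rv hull_diff Z A0[OF s] Yh)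
      show "AE \<omega> in M. (\<lambda>n. Z (s n) \<omega> - Y \<omega>) \<longlonglongrightarrow> 0"
        using lim[OF s] by eventually_elim (rule LIM_zero)
    qed
    then have "\<forall>\<^sub>F n in sequentially. dist (expectation (\<lambda>\<omega>. (Z (s n) \<omega> - Y \<omega>)\<^sup>2)) 0 < e"
      using e(1) by (rule tendstoD)
    then show False
      using far by (auto simp: eventually_sequentially)
  qed
  then show "L2_tendsto M Z Y F"
    using Yh Z unfolding L2_tendsto_def F
    by (auto intro!: normal_rv_square_integrable hull_normal_rv exI[of _ 0])
qed

end

section \<open>Path limits as mean-square limits\<close>

text \<open>By uniform continuity the error on each piece is at most \<open>e / c\<close> times its
  length, wherever the tag lies; additivity of length over the division then bounds the
  total.\<close>

lemma riemann_sums_tendsto_integral: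
  fixes w :: "real \<Rightarrow> real"
  assumes w: "continuous_on {a..b} w"
    and p: "\<And>n. p n tagged_division_of {a..b}" "\<And>n. (\<lambda>x. ball x (1 / Suc n)) fine p n"
  shows "(\<lambda>n. \<Sum>(x, K)\<in>p n. measure lborel K * w x) \<longlonglongrightarrow> integral {a..b} w"
proof (rule LIMSEQ_I)
  fix e :: real assume e: "e > 0"
  \<comment> \<open>The added 1 keeps \<open>c\<close> positive when the interval has length 0, as
    happens at the left endpoint, and makes the final estimate strict.\<close>
  define c where "c = measure lborel {a..b} + 1"
  have c: "c > 0" by (simp add: c_def add_nonneg_pos)
  have "uniformly_continuous_on {a..b} w"
    using w by (rule compact_uniformly_continuous) simp
  then obtain d where d: "d > 0" "\<And>x y. x \<in> {a..b} \<Longrightarrow> y \<in> {a..b} \<Longrightarrow> dist y x < d \<Longrightarrow> dist (w y) (w x) < e / c"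
    unfolding uniformly_continuous_on_def using e c by (metis divide_pos_pos)
  obtain N where N: "1 / Suc N < d"
    using d(1) nat_approx_posE by blast
  show "\<exists>N. \<forall>n\<ge>N. norm ((\<Sum>(x, K)\<in>p n. measure lborel K * w x) - integral {a..b} w) < e"
  proof (intro exI allI impI)
    fix n assume "n \<ge> N"
    then have nd: "1 / Suc n < d"
      using N by (auto intro: le_less_trans[rotated] simp: frac_le)
    have fin: "finite (p n)"
      using p(1) by (rule tagged_division_of_finite)
    have wint: "w integrable_on {a..b}"
      using w by (rule integrable_continuous_real)
    have piece: "\<bar>measure lborel K * w x - integral K w\<bar> \<le> e / c * measure lborel K" if xK: "(x, K) \<in> p n" for x K
    proof -
      note td = tagged_division_ofD[OF p(1)[of n]]
      have x: "x \<in> K" "K \<subseteq> {a..b}"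
        using td(2,3)[OF xK] by auto
      obtain l u where K: "K = {l..u}"
        using td(4)[OF xK] unfolding cbox_interval by blast
      have Kb: "K \<subseteq> ball x (1 / Suc n)"
        using p(2)[of n] xK by (auto simp: fine_def)
      have "continuous_on K w"
        using w x(2) by (rule continuous_on_subset)
      then have wi: "w integrable_on K"
        unfolding K by (rule integrable_continuous_real)
      then have hi: "((\<lambda>y. w x - w y) has_integral (measure lborel K * w x - integral K w)) K"
        using has_integral_diff[OF has_integral_const_real[of "w x" l u] integrable_integral[OF wi[unfolded K]]]
        by (simp add: K)
      have "norm (measure lborel K * w x - integral K w) \<le> e / c * measure lborel {l..u}"
      proof (rule has_integral_bound[where a = l and b = u, unfolded cbox_interval])
        show "0 \<le> e / c" using e c by simp
        show "((\<lambda>y. w x - w y) has_integral (measure lborel K * w x - integral K w)) {l..u}"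
          using hi by (simp add: K)
        fix y assume y: "y \<in> {l..u}"
        then have "dist x y < d"
          using Kb nd K by fastforce
        then have "dist (w x) (w y) < e / c"
          using x y K by (intro d(2)) auto
        then show "norm (w x - w y) \<le> e / c"
          by (simp add: dist_norm)
      qed
      then show ?thesis by (simp add: K)
    qed
    have "(\<Sum>(x, K)\<in>p n. measure lborel K * w x) - integral {a..b} w
        = (\<Sum>(x, K)\<in>p n. measure lborel K * w x - integral K w)"
      using integral_combine_tagged_division_topdown[of w a b "p n"] wint p(1)
      by (simp add: sum_subtractf split_def box_real)
    also have "\<bar>\<dots>\<bar> \<le> (\<Sum>(x, K)\<in>p n. e / c * measure lborel K)"
      by (rule order_trans[OF sum_abs sum_mono]) (use piece in auto)
    also have "\<dots> = e / c * measure lborel {a..b}"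
      using additive_content_tagged_division[of "p n" a b] p(1)
      by (simp only: sum_distrib_left[symmetric] split_def cbox_interval)
    also have "\<dots> < e"
    proof -
      have "e / c * measure lborel {a..b} < e / c * c"
        using e c by (intro mult_strict_left_mono) (auto simp: c_def)
      then show ?thesis using c by simp
    qed
    finally show "norm ((\<Sum>(x, K)\<in>p n. measure lborel K * w x) - integral {a..b} w) < e"
      by simp
  qed
qed

section \<open>Countable bases of the two limit filters\<close>

text \<open>Together with \<open>punctured_nbhd\<close> below, this puts the filter of a mean-square
  limit into the form that \<open>hull_L2_tendsto\<close> asks for.\<close>

definition fine_tagged_divisions :: "real \<Rightarrow> real \<Rightarrow> nat \<Rightarrow> (real \<times> real set) set set" where
  "fine_tagged_divisions a b n =
     {p. p tagged_division_of {a..b} \<and> (\<lambda>x. ball x (1 / Suc n)) fine p}"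

text \<open>This is Cousin's lemma. It makes \<open>riemann_filter\<close> proper, without which its
  limits would not be unique.\<close>

lemma fine_tagged_divisions_nonempty: "fine_tagged_divisions a b n \<noteq> {}"
proof -
  have "gauge (\<lambda>x :: real. ball x (1 / Suc n))"
    by (rule gauge_ball) simp
  then obtain p where "p tagged_division_of {a..b}" "(\<lambda>x. ball x (1 / Suc n)) fine p"
    by (rule fine_division_exists_real)
  then show ?thesis by (auto simp: fine_tagged_divisions_def)
qed

lemma fine_ball_mono: "(\<lambda>x. ball x d) fine p \<Longrightarrow> d \<le> d' \<Longrightarrow> (\<lambda>x. ball x d') fine p"
  unfolding fine_def by fastforce

lemma decseq_fine_tagged_divisions: "decseq (fine_tagged_divisions a b)"
proof (unfold decseq_def, intro allI impI subsetI)
  fix m n p assume "m \<le> n" and p: "p \<in> fine_tagged_divisions a b n"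
  then have "1 / real (Suc n) \<le> 1 / Suc m"
    by (intro frac_le) auto
  then show "p \<in> fine_tagged_divisions a b m"
    using p fine_ball_mono[of "1 / real (Suc n)" p "1 / Suc m"] by (simp add: fine_tagged_divisions_def)
qed

lemma eventually_riemann_filter:
  "eventually P (riemann_filter a b) \<longleftrightarrow> (\<exists>n. \<forall>p\<in>fine_tagged_divisions a b n. P p)"
proof -
  let ?S = "\<lambda>d. {p. p tagged_division_of {a..b} \<and> (\<lambda>x. ball x d) fine p}"
  have "eventually P (riemann_filter a b) \<longleftrightarrow> (\<exists>d\<in>{0<..}. eventually P (principal (?S d)))"
    unfolding riemann_filter_def
  proof (rule eventually_INF_base)
    fix d e :: real assume "d \<in> {0<..}" "e \<in> {0<..}"
    then show "\<exists>x\<in>{0<..}. principal (?S x) \<le> inf (principal (?S d)) (principal (?S e))"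
      using fine_ball_mono[of "min d e" _ d] fine_ball_mono[of "min d e" _ e]
      by (intro bexI[of _ "min d e"]) auto
  qed auto
  also have "\<dots> \<longleftrightarrow> (\<exists>n. \<forall>p\<in>fine_tagged_divisions a b n. P p)"
  proof
    assume "\<exists>d\<in>{0<..}. eventually P (principal (?S d))"
    then obtain d where d: "d > 0" "\<And>p. p \<in> ?S d \<Longrightarrow> P p"
      by (auto simp: eventually_principal)
    obtain N where "1 / Suc N < d"
      using d(1) nat_approx_posE by blast
    then show "\<exists>n. \<forall>p\<in>fine_tagged_divisions a b n. P p"
      using d(2) fine_ball_mono[of "1 / Suc N" _ d]
      by (intro exI[of _ N]) (auto simp: fine_tagged_divisions_def)
  next
    assume "\<exists>n. \<forall>p\<in>fine_tagged_divisions a b n. P p"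
    then obtain n where "\<forall>p\<in>fine_tagged_divisions a b n. P p" ..
    then show "\<exists>d\<in>{0<..}. eventually P (principal (?S d))"
      by (intro bexI[of _ "1 / Suc n"]) (auto simp: eventually_principal fine_tagged_divisions_def)
  qed
  finally show ?thesis .
qed

definition punctured_nbhd :: "real set \<Rightarrow> real \<Rightarrow> nat \<Rightarrow> real set" where
  "punctured_nbhd I t n = {s \<in> I. s \<noteq> t \<and> dist s t < 1 / Suc n}"

lemma eventually_at_within_punctured_nbhd:
  "eventually P (at t within I) \<longleftrightarrow> (\<exists>n. \<forall>s\<in>punctured_nbhd I t n. P s)"
proof
  assume "eventually P (at t within I)"
  then obtain d where d: "d > 0" "\<And>s. s \<in> I \<Longrightarrow> s \<noteq> t \<Longrightarrow> dist s t < d \<Longrightarrow> P s"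
    by (auto simp: eventually_at)
  obtain N where "1 / Suc N < d"
    using d(1) nat_approx_posE by blast
  then show "\<exists>n. \<forall>s\<in>punctured_nbhd I t n. P s"
    using d(2) by (intro exI[of _ N]) (auto simp: punctured_nbhd_def)
next
  assume "\<exists>n. \<forall>s\<in>punctured_nbhd I t n. P s"
  then obtain n where "\<forall>s\<in>punctured_nbhd I t n. P s" ..
  then show "eventually P (at t within I)"
    unfolding eventually_at by (intro exI[of _ "1 / Suc n"]) (auto simp: punctured_nbhd_def)
qed

lemma decseq_punctured_nbhd: "decseq (punctured_nbhd I t)"
proof (unfold decseq_def, intro allI impI subsetI)
  fix m n s assume "m \<le> n" and s: "s \<in> punctured_nbhd I t n"
  then have "1 / real (Suc n) \<le> 1 / Suc m"
    by (intro frac_le) auto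
  then show "s \<in> punctured_nbhd I t m"
    using s by (auto simp: punctured_nbhd_def)
qed

lemma punctured_nbhd_nonempty:
  assumes "at t within I \<noteq> bot"
  shows "punctured_nbhd I t n \<noteq> {}"
proof
  assume "punctured_nbhd I t n = {}"
  then have "eventually (\<lambda>_. False) (at t within I)"
    unfolding eventually_at_within_punctured_nbhd by (intro exI[of _ n]) simp
  then show False using assms by simp
qed

lemma difference_quotients_tendsto:
  fixes w :: "real \<Rightarrow> real"
  assumes w: "(w has_vector_derivative D) (at t within I)" and s: "\<And>n. s n \<in> punctured_nbhd I t n"
  shows "(\<lambda>n. (w (s n) - w t) / (s n - t)) \<longlonglongrightarrow> D"
proof -
  have lim: "((\<lambda>s. (w s - w t) / (s - t)) \<longlongrightarrow> D) (at t within I)"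
    using w by (simp add: has_real_derivative_iff_has_vector_derivative[symmetric] has_field_derivative_iff)
  have "filterlim s (at t within I) sequentially"
    unfolding filterlim_iff eventually_at_within_punctured_nbhd
  proof (intro allI impI, elim exE)
    fix P n assume P: "\<forall>s\<in>punctured_nbhd I t n. P s"
    have "s m \<in> punctured_nbhd I t n" if "m \<ge> n" for m
      using s[of m] decseq_punctured_nbhd[of I t] that by (auto simp: decseq_def)
    then show "\<forall>\<^sub>F m in sequentially. P (s m)"
      using P by (auto simp: eventually_sequentially)
  qed
  then show ?thesis
    using filterlim_compose[OF lim] by blast
qed

text \<open>One fixed sequence of difference quotients converges at every point of the space, so the
  derivative is a pointwise limit of measurable functions. Existence for almost every path would not
  suffice over an incomplete measure.\<close>

lemma measurable_path_derivative:
  fixes W :: "real \<Rightarrow> 'w \<Rightarrow> real"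
  assumes W: "\<And>s. s \<in> I \<Longrightarrow> W s \<in> borel_measurable M" and t: "t \<in> I" "at t within I \<noteq> bot"
    and D: "\<And>\<omega>. \<omega> \<in> space M \<Longrightarrow> ((\<lambda>s. W s \<omega>) has_vector_derivative D \<omega>) (at t within I)"
  shows "D \<in> borel_measurable M"
proof -
  obtain s where s: "\<And>n. s n \<in> punctured_nbhd I t n"
    using choice[of "\<lambda>n s. s \<in> punctured_nbhd I t n"] punctured_nbhd_nonempty[OF t(2)] by blast
  then have [measurable]: "W (s n) \<in> borel_measurable M" "W t \<in> borel_measurable M" for n
    using t by (auto intro!: W simp: punctured_nbhd_def)
  show ?thesis
    using difference_quotients_tendsto[OF D s]
    by (rule borel_measurable_LIMSEQ_real[of M "\<lambda>n \<omega>. (W (s n) \<omega> - W t \<omega>) / (s n - t)"]) simp_all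
qed

lemma measurable_path_integral:
  fixes W :: "real \<Rightarrow> 'w \<Rightarrow> real"
  assumes W: "\<And>s. s \<in> {a..b} \<Longrightarrow> W s \<in> borel_measurable M"
    and c: "\<And>\<omega>. \<omega> \<in> space M \<Longrightarrow> continuous_on {a..b} (\<lambda>s. W s \<omega>)"
  shows "(\<lambda>\<omega>. integral {a..b} (\<lambda>s. W s \<omega>)) \<in> borel_measurable M"
proof -
  obtain p where p: "\<And>n. p n \<in> fine_tagged_divisions a b n"
    using choice[of "\<lambda>n p. p \<in> fine_tagged_divisions a b n"] fine_tagged_divisions_nonempty by blast
  show ?thesis
  proof (rule borel_measurable_LIMSEQ_real)
    show "(\<lambda>n. \<Sum>(x, K)\<in>p n. measure lborel K * W x \<omega>) \<longlonglongrightarrow> integral {a..b} (\<lambda>s. W s \<omega>)"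
      if "\<omega> \<in> space M" for \<omega>
      using c[OF that] p by (intro riemann_sums_tendsto_integral) (auto simp: fine_tagged_divisions_def)
    show "(\<lambda>\<omega>. \<Sum>(x, K)\<in>p n. measure lborel K * W x \<omega>) \<in> borel_measurable M" for n
    proof -
      have "x \<in> {a..b}" if "(x, K) \<in> p n" for x K
        using p[of n] that tagged_division_ofD(2,3)[of "p n" "{a..b}" x K] by (auto simp: fine_tagged_divisions_def)
      then show ?thesis
        using W unfolding split_def
        by (intro borel_measurable_sum borel_measurable_times borel_measurable_const) auto
    qed
  qed
qed

section \<open>Identification of mean-square derivatives and integrals\<close>

context gaussian_family
begin

text \<open>The path derivative \<open>D\<close> is shown to be a mean-square limit first; only then
  does \<open>ms_deriv\<close> denote one, and uniqueness equates the two. Membership in the hull is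
  part of the conclusion so that the step can be iterated.\<close>

lemma hull_ms_deriv:
  assumes h: "\<And>s. s \<in> I \<Longrightarrow> h s \<in> \<H>" and W: "\<And>s. s \<in> I \<Longrightarrow> AE \<omega> in M. h s \<omega> = W s \<omega>"
    and t: "t \<in> I" "at t within I \<noteq> bot" and D: "D \<in> borel_measurable M"
    and deriv: "AE \<omega> in M. ((\<lambda>s. W s \<omega>) has_vector_derivative D \<omega>) (at t within I)"
  shows "ms_deriv M I h t \<in> \<H>" and "AE \<omega> in M. ms_deriv M I h t \<omega> = D \<omega>"
proof -
  let ?Z = "\<lambda>s \<omega>. (h s \<omega> - h t \<omega>) / (s - t)"
  have "AE \<omega> in M. (\<lambda>n. ?Z (s n) \<omega>) \<longlonglongrightarrow> D \<omega>" if s: "\<And>n. s n \<in> punctured_nbhd I t n" for s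
  proof -
    \<comment> \<open>A sequence involves countably many times, so agreement of \<open>h\<close> and
      \<open>W\<close> at each single time is enough; whole paths are never compared.\<close>
    have "AE \<omega> in M. \<forall>n. h (s n) \<omega> = W (s n) \<omega>"
      unfolding AE_all_countable using s by (auto intro!: W simp: punctured_nbhd_def)
    with deriv W[OF t(1)] show ?thesis
      by eventually_elim (use difference_quotients_tendsto[OF _ s] in auto)
  qed
  moreover have "?Z s \<in> \<H>" if "s \<in> I" for s
    using hull_scale[OF hull_diff[OF h h], of s t "1 / (s - t)"] that t by simp
  ultimately have L: "L2_tendsto M ?Z D (at t within I)" "D \<in> \<H>"
    using hull_L2_tendsto[OF eventually_at_within_punctured_nbhd punctured_nbhd_nonempty[OF t(2)]
        decseq_punctured_nbhd, of ?Z D] D by (auto simp: punctured_nbhd_def)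
  have "has_ms_derivative M I h (ms_deriv M I h t) t"
    unfolding ms_deriv_def by (rule someI[of _ D]) (unfold has_ms_derivative_def, rule L(1))
  then have L': "L2_tendsto M ?Z (ms_deriv M I h t) (at t within I)"
    by (simp add: has_ms_derivative_def)
  show eq: "AE \<omega> in M. ms_deriv M I h t \<omega> = D \<omega>"
    using L2_tendsto_unique[OF L' L(1) t(2)] .
  show "ms_deriv M I h t \<in> \<H>"
  proof (rule hull_AE_eq[OF L(2)])
    show "ms_deriv M I h t \<in> borel_measurable M"
      using L' by (simp add: L2_tendsto_def square_integrable_def)
    show "AE \<omega> in M. D \<omega> = ms_deriv M I h t \<omega>"
      using eq by eventually_elim simp
  qed
qed

lemma hull_ms_integral:
  assumes h: "\<And>s. s \<in> {a..b} \<Longrightarrow> h s \<in> \<H>" and W: "\<And>s. s \<in> {a..b} \<Longrightarrow> AE \<omega> in M. h s \<omega> = W s \<omega>"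
    and Y: "(\<lambda>\<omega>. integral {a..b} (\<lambda>s. W s \<omega>)) \<in> borel_measurable M"
    and cont: "AE \<omega> in M. continuous_on {a..b} (\<lambda>s. W s \<omega>)"
  shows "(\<lambda>\<omega>. integral {a..b} (\<lambda>s. W s \<omega>)) \<in> \<H>"
    and "AE \<omega> in M. ms_integral M a b h \<omega> = integral {a..b} (\<lambda>s. W s \<omega>)"
proof -
  let ?Z = "\<lambda>p \<omega>. \<Sum>(x, K)\<in>p. measure lborel K * h x \<omega>"
  let ?Y = "\<lambda>\<omega>. integral {a..b} (\<lambda>s. W s \<omega>)"
  let ?A = "fine_tagged_divisions a b"
  have tag: "x \<in> {a..b}" if "p \<in> ?A n" "(x, K) \<in> p" for p n x K
    using that tagged_division_ofD(2,3)[of p "{a..b}" x K] by (auto simp: fine_tagged_divisions_def)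
  have lim: "AE \<omega> in M. (\<lambda>n. ?Z (p n) \<omega>) \<longlonglongrightarrow> ?Y \<omega>" if p: "\<And>n. p n \<in> ?A n" for p
  proof -
    \<comment> \<open>A tagged division has finitely many tags, so a sequence of divisions again
      meets only countably many null sets.\<close>
    have "AE \<omega> in M. \<forall>xK\<in>p n. h (fst xK) \<omega> = W (fst xK) \<omega>" for n
    proof (rule AE_finite_allI)
      show "finite (p n)"
        using p[of n] by (auto simp: fine_tagged_divisions_def intro: tagged_division_of_finite)
    qed (use tag[OF p] W in auto)
    then have "AE \<omega> in M. \<forall>n. \<forall>xK\<in>p n. h (fst xK) \<omega> = W (fst xK) \<omega>"
      unfolding AE_all_countable by blast
    with cont show ?thesis
    proof eventually_elim
      case (elim \<omega>)
      have "(\<lambda>n. \<Sum>(x, K)\<in>p n. measure lborel K * W x \<omega>) \<longlonglongrightarrow> ?Y \<omega>"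
        using elim(1) p by (intro riemann_sums_tendsto_integral) (auto simp: fine_tagged_divisions_def)
      moreover have "?Z (p n) \<omega> = (\<Sum>(x, K)\<in>p n. measure lborel K * W x \<omega>)" for n
        using elim(2) by (intro sum.cong) (auto simp: split_def)
      ultimately show ?case by simp
    qed
  qed
  have "?Z p \<in> \<H>" if "p \<in> ?A 0" for p
    unfolding split_def using tag[OF that] by (intro hull_sum hull_scale h) auto
  note hull_L2_tendsto[where Z = ?Z and Y = ?Y, OF eventually_riemann_filter[of _ a b]
      fine_tagged_divisions_nonempty decseq_fine_tagged_divisions this Y lim]
  then have L: "L2_tendsto M ?Z ?Y (riemann_filter a b)" "?Y \<in> \<H>"
    by simp_all
  show "?Y \<in> \<H>" by fact
  have "has_ms_integral M a b h (ms_integral M a b h)"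
    unfolding ms_integral_def by (rule someI[of _ ?Y]) (unfold has_ms_integral_def, rule L(1))
  then have L': "L2_tendsto M ?Z (ms_integral M a b h) (riemann_filter a b)"
    by (simp add: has_ms_integral_def)
  have "riemann_filter a b \<noteq> bot"
  proof
    assume "riemann_filter a b = bot"
    then have "eventually (\<lambda>_. False) (riemann_filter a b)"
      by simp
    then show False
      using fine_tagged_divisions_nonempty unfolding eventually_riemann_filter by blast
  qed
  with L' L(1) show "AE \<omega> in M. ms_integral M a b h \<omega> = ?Y \<omega>"
    by (rule L2_tendsto_unique)
qed

end

section \<open>Path operators\<close>

lemma Cr_on_has_derivative:
  assumes "Cr_on r I w" "k < r" "t \<in> I"
  shows "((deriv_in I ^^ k) w has_vector_derivative (deriv_in I ^^ Suc k) w t) (at t within I)"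
proof -
  have "(deriv_in I ^^ k) w differentiable (at t within I)"
    using assms by (auto simp: Cr_on_def differentiable_on_def)
  then show ?thesis
    unfolding vector_derivative_works by (simp add: deriv_in_def)
qed

lemma Cr_on_continuous_on:
  assumes "Cr_on r I w"
  shows "continuous_on I w"
  using assms by (cases "r = 0") (auto simp: Cr_on_def dest!: spec[of _ 0] intro: differentiable_imp_continuous_on)

text \<open>The path operator is a Lebesgue integral, while Riemann sums and Taylor's formula
  produce the gauge integral; for continuous paths they coincide.\<close>

lemma iter_integral_eq_integral:
  assumes "continuous_on {a..b} w" "t \<in> {a..b}"
  shows "iter_integral a q w t = 1 / fact (q - 1) * integral {a..t} (\<lambda>u. (t - u) ^ (q - 1) * w u)"
proof -
  have "continuous_on {a..t} (\<lambda>u. (t - u) ^ (q - 1) * w u)"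
    using assms by (intro continuous_intros continuous_on_subset[OF assms(1)]) auto
  then show ?thesis
    unfolding iter_integral_def by (subst set_borel_integral_eq_integral(2)[OF borel_integrable_atLeastAtMost']) auto
qed

abbreviation (input) primitive :: "real \<Rightarrow> (real \<Rightarrow> real) \<Rightarrow> real \<Rightarrow> real" where
  "primitive a w \<equiv> (\<lambda>t. integral {a..t} w)"

lemma continuous_on_iterated_primitive:
  assumes "continuous_on {a..b} w"
  shows "continuous_on {a..b} ((primitive a ^^ q) w)"
proof (induction q)
  case (Suc q)
  then show ?case
    by (auto intro!: indefinite_integral_continuous_1 integrable_continuous_real)
qed (use assms in simp)

lemma iterated_primitive_has_derivative:
  assumes "continuous_on {a..b} w" "t \<in> {a..b}"
  shows "((primitive a ^^ Suc q) w has_vector_derivative (primitive a ^^ q) w t) (at t within {a..b})"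
  using integral_has_vector_derivative[OF continuous_on_iterated_primitive[OF assms(1)] assms(2)] by simp

text \<open>Cauchy's formula for repeated integration is Taylor's formula with integral remainder for the
  iterated primitive, whose Taylor coefficients at \<open>a\<close> all vanish.\<close>

lemma iter_integral_eq_iterated_primitive:
  assumes w: "continuous_on {a..b} w" and t: "t \<in> {a..b}" and q: "q > 0"
  shows "iter_integral a q w t = (primitive a ^^ q) w t"
proof -
  \<comment> \<open>Differentiating the \<open>q\<close>-fold primitive \<open>m\<close> times
    removes \<open>m\<close> integrations; thus \<open>?D q\<close> is \<open>w\<close>, the
    function under the remainder integral.\<close>
  let ?D = "\<lambda>m. (primitive a ^^ (q - m)) w"
  have zero: "(primitive a ^^ k) w a = 0" if "k > 0" for k
    using that by (cases k) auto
  have "((\<lambda>x. ((t - x) ^ (q - 1) / fact (q - 1)) *\<^sub>R ?D q x) has_integral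
      ?D 0 t - (\<Sum>i<q. ((t - a) ^ i / fact i) *\<^sub>R ?D i a)) {a..t}"
  proof (rule Taylor_has_integral[of q ?D "?D 0"])
    fix m s assume "m < q" "a \<le> s" "s \<le> t"
    then have "((primitive a ^^ Suc (q - Suc m)) w has_vector_derivative ?D (Suc m) s) (at s within {a..b})"
      using t by (intro iterated_primitive_has_derivative[OF w]) auto
    then show "(?D m has_vector_derivative ?D (Suc m) s) (at s within {a..t})"
      using \<open>m < q\<close> t by (auto simp: Suc_diff_Suc simp del: funpow.simps intro: has_vector_derivative_within_subset)
  qed (use q t in auto)
  moreover have "(\<Sum>i<q. ((t - a) ^ i / fact i) *\<^sub>R ?D i a) = 0"
    by (intro sum.neutral) (simp add: zero)
  ultimately have "((\<lambda>x. 1 / fact (q - 1) * ((t - x) ^ (q - 1) * w x)) has_integral (primitive a ^^ q) w t) {a..t}"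
    by simp
  then have "integral {a..t} (\<lambda>x. 1 / fact (q - 1) * ((t - x) ^ (q - 1) * w x)) = (primitive a ^^ q) w t"
    by (rule integral_unique)
  then show ?thesis
    unfolding iter_integral_eq_integral[OF w t] by (simp only: integral_mult_right)
qed

text \<open>For positive orders, Cauchy's formula replaces an integral whose kernel depends on the
  point of differentiation by an iterated primitive, so the fundamental theorem of calculus applies
  directly.\<close>

lemma signed_op_has_derivative:
  assumes w: "Cr_on r {a..b} w" and p: "p \<in> {- int r + 1..int r}" and t: "t \<in> {a<..<b}"
  shows "((\<lambda>s. signed_op a b p w s) has_real_derivative signed_op a b (p - 1) w t) (at t)"
proof -
  have at: "at t within {a..b} = at t"
    using t by (intro at_within_interior) auto
  note c = Cr_on_continuous_on[OF w]
  show ?thesis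
  proof (cases "p \<le> 0")
    case True
    define k where "k = nat (- p)"
    have k: "k < r" "nat (- (p - 1)) = Suc k"
      using True p by (auto simp: k_def)
    have "((deriv_in {a..b} ^^ k) w has_vector_derivative (deriv_in {a..b} ^^ Suc k) w t) (at t)"
      using Cr_on_has_derivative[OF w k(1), of t] t at by auto
    moreover have "signed_op a b p w = (deriv_in {a..b} ^^ k) w"
      using True by (auto simp: signed_op_def k_def)
    moreover have "signed_op a b (p - 1) w = (deriv_in {a..b} ^^ Suc k) w"
      using True k(2) by (simp add: signed_op_def)
    ultimately show ?thesis
      by (simp add: has_real_derivative_iff_has_vector_derivative)
  next
    case False
    define q where "q = nat p - 1"
    have q: "p = int (Suc q)" "p - 1 = int q"
      using False by (auto simp: q_def)
    \<comment> \<open>The case \<open>n = 0\<close> is the identity branch of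
      \<open>signed_op\<close>; including it lets \<open>p = 1\<close>, where integration meets the
      identity, go through like the other orders.\<close>
    have prim: "signed_op a b (int n) w s = (primitive a ^^ n) w s" if "s \<in> {a..b}" for n s
      using iter_integral_eq_iterated_primitive[OF c that, of n] by (simp add: signed_op_def)
    have "((primitive a ^^ Suc q) w has_vector_derivative (primitive a ^^ q) w t) (at t)"
      using iterated_primitive_has_derivative[OF c, of t q] t at by auto
    \<comment> \<open>Beyond the interval the two functions may differ, so they are equated only
      near the interior point \<open>t\<close>.\<close>
    moreover have "\<forall>\<^sub>F s in nhds t. signed_op a b p w s = (primitive a ^^ Suc q) w s"
      using eventually_nhds_in_open[of "{a<..<b}" t] t
      by (auto simp: q(1) prim simp del: funpow.simps of_nat_Suc elim!: eventually_mono)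
    moreover have "signed_op a b (p - 1) w t = (primitive a ^^ q) w t"
      unfolding q(2) using t by (intro prim) auto
    ultimately show ?thesis
      by (simp add: has_real_derivative_iff_has_vector_derivative[symmetric] DERIV_cong_ev del: funpow.simps)
  qed
qed

text \<open>The summand \<open>j = Suc n\<close> is the constant of integration of the last step and
  disappears; each other power drops by one, its factorial absorbing the exponent.\<close>

lemma boundary_poly_has_derivative:
  "((\<lambda>s. boundary_poly a \<kappa> (Suc n) s \<omega>) has_real_derivative boundary_poly a \<kappa> n t \<omega>) (at t)"
proof -
  have "((\<lambda>s. (\<Sum>j=1..n. (s - a) ^ Suc (n - j) / fact (Suc (n - j)) * \<kappa> j \<omega>) + \<kappa> (Suc n) \<omega>)
      has_real_derivative (\<Sum>j=1..n. (t - a) ^ (n - j) / fact (n - j) * \<kappa> j \<omega>) + 0) (at t)"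
  proof (intro DERIV_add DERIV_const DERIV_sum DERIV_cmult_right)
    fix j
    have "((\<lambda>s. (s - a) ^ Suc k / fact (Suc k)) has_real_derivative
        real (Suc k) * (t - a) ^ k / fact (Suc k)) (at t)" for k
      by (auto intro!: derivative_eq_intros simp del: power_Suc fact_Suc of_nat_Suc)
    moreover have "real (Suc k) * (t - a) ^ k / fact (Suc k) = (t - a) ^ k / fact k" for k
      by (simp del: of_nat_Suc)
    ultimately show "((\<lambda>s. (s - a) ^ Suc (n - j) / fact (Suc (n - j)))
        has_real_derivative (t - a) ^ (n - j) / fact (n - j)) (at t)"
      by metis
  qed
  moreover have "boundary_poly a \<kappa> (Suc n) s \<omega>
      = (\<Sum>j=1..n. (s - a) ^ Suc (n - j) / fact (Suc (n - j)) * \<kappa> j \<omega>) + \<kappa> (Suc n) \<omega>" for s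
    unfolding boundary_poly_def by (simp add: Suc_diff_le)
  ultimately show ?thesis
    by (simp add: boundary_poly_def)
qed

section \<open>Path operators on Gaussian processes\<close>

context gaussian_family
begin

text \<open>The three claims form one induction: hull membership and almost sure agreement at order
  \<open>k\<close> are the premises of \<open>hull_ms_deriv\<close>, and measurability at order
  \<open>k\<close> gives that of the next path derivative.\<close>

lemma hull_ms_deriv_iterate:
  assumes h: "\<And>t. t \<in> {a..b} \<Longrightarrow> h t \<in> \<H>" and W: "\<And>t. t \<in> {a..b} \<Longrightarrow> AE \<omega> in M. h t \<omega> = W t \<omega>"
    and mW: "\<And>t. t \<in> {a..b} \<Longrightarrow> W t \<in> borel_measurable M"
    and Cr: "\<And>\<omega>. \<omega> \<in> space M \<Longrightarrow> Cr_on r {a..b} (\<lambda>t. W t \<omega>)"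
    and ab: "a < b" and k: "k \<le> r" and t: "t \<in> {a..b}"
  shows "(ms_deriv M {a..b} ^^ k) h t \<in> \<H>"
    and "AE \<omega> in M. (ms_deriv M {a..b} ^^ k) h t \<omega> = (deriv_in {a..b} ^^ k) (\<lambda>s. W s \<omega>) t"
    and "(\<lambda>\<omega>. (deriv_in {a..b} ^^ k) (\<lambda>s. W s \<omega>) t) \<in> borel_measurable M"
  using k t
proof (induction k arbitrary: t)
  case 0
  case 1 then show ?case using h by simp
  case 2 then show ?case using W by simp
  case 3 then show ?case using mW by simp
next
  case (Suc k)
  let ?D = "\<lambda>k s \<omega>. (deriv_in {a..b} ^^ k) (\<lambda>s. W s \<omega>) s"
  \<comment> \<open>A nondegenerate interval has no isolated points, so one-sided derivatives at the
    endpoints are covered too.\<close>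
  have nb: "at s within {a..b} \<noteq> bot" if "s \<in> {a..b}" for s
    using that ab by (simp add: trivial_limit_within islimpt_Icc)
  have d: "((\<lambda>s. ?D k s \<omega>) has_vector_derivative ?D (Suc k) t \<omega>) (at t within {a..b})"
    if "\<omega> \<in> space M" "Suc k \<le> r" "t \<in> {a..b}" for \<omega> t
    using Cr_on_has_derivative[OF Cr[OF that(1)], of k t] that by simp
  have meas: "?D (Suc k) t \<in> borel_measurable M" if "Suc k \<le> r" "t \<in> {a..b}" for t
    using that by (intro measurable_path_derivative[OF _ that(2) nb[OF that(2)] d[OF _ that]] Suc(3)) auto
  have *: "ms_deriv M {a..b} ((ms_deriv M {a..b} ^^ k) h) t \<in> \<H>"
    "AE \<omega> in M. ms_deriv M {a..b} ((ms_deriv M {a..b} ^^ k) h) t \<omega> = ?D (Suc k) t \<omega>"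
    if "Suc k \<le> r" "t \<in> {a..b}" for t
    using hull_ms_deriv[of "{a..b}" "(ms_deriv M {a..b} ^^ k) h" "?D k" t "?D (Suc k) t", OF Suc(1,2) that(2) nb[OF that(2)] meas[OF that]]
      d[OF _ that] that(1) by auto
  case 1 then show ?case using * by simp
  case 2 then show ?case using * by simp
  case 3 then show ?case using meas by simp
qed

text \<open>For fixed \<open>t\<close> the kernel is deterministic, so the weighted variables remain
  in the hull and the result on plain integrals applies on \<open>{a..t}\<close>.\<close>

lemma hull_ms_iter_integral:
  assumes h: "\<And>t. t \<in> {a..b} \<Longrightarrow> h t \<in> \<H>" and W: "\<And>t. t \<in> {a..b} \<Longrightarrow> AE \<omega> in M. h t \<omega> = W t \<omega>"
    and mW: "\<And>t. t \<in> {a..b} \<Longrightarrow> W t \<in> borel_measurable M"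
    and cont: "\<And>\<omega>. \<omega> \<in> space M \<Longrightarrow> continuous_on {a..b} (\<lambda>t. W t \<omega>)"
    and t: "t \<in> {a..b}"
  shows "(\<lambda>\<omega>. iter_integral a q (\<lambda>s. W s \<omega>) t) \<in> \<H>"
    and "AE \<omega> in M. 1 / fact (q - 1) * ms_integral M a t (\<lambda>u \<omega>. (t - u) ^ (q - 1) * h u \<omega>) \<omega>
      = iter_integral a q (\<lambda>s. W s \<omega>) t"
proof -
  let ?V = "\<lambda>u \<omega>. (t - u) ^ (q - 1) * W u \<omega>"
  let ?Y = "\<lambda>\<omega>. integral {a..t} (\<lambda>u. ?V u \<omega>)"
  have sub: "u \<in> {a..b}" if "u \<in> {a..t}" for u
    using that t by auto
  have c: "continuous_on {a..t} (\<lambda>u. ?V u \<omega>)" if "\<omega> \<in> space M" for \<omega>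
    using t by (intro continuous_intros continuous_on_subset[OF cont[OF that]]) auto
  have mV: "?V u \<in> borel_measurable M" if "u \<in> {a..t}" for u
    using mW[OF sub[OF that]] by simp
  have hV: "(\<lambda>\<omega>. (t - u) ^ (q - 1) * h u \<omega>) \<in> \<H>" if "u \<in> {a..t}" for u
    by (intro hull_scale h sub that)
  have eqV: "AE \<omega> in M. (t - u) ^ (q - 1) * h u \<omega> = ?V u \<omega>" if "u \<in> {a..t}" for u
    using W[OF sub[OF that]] by eventually_elim simp
  have mY: "?Y \<in> borel_measurable M"
    by (rule measurable_path_integral[OF mV c])
  have cAE: "AE \<omega> in M. continuous_on {a..t} (\<lambda>u. ?V u \<omega>)"
    using c by (intro AE_I2)
  have iter: "iter_integral a q (\<lambda>s. W s \<omega>) t = 1 / fact (q - 1) * ?Y \<omega>" if "\<omega> \<in> space M" for \<omega>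
    by (rule iter_integral_eq_integral[OF cont[OF that] t])
  have R: "?Y \<in> \<H>"
    "AE \<omega> in M. ms_integral M a t (\<lambda>u \<omega>. (t - u) ^ (q - 1) * h u \<omega>) \<omega> = ?Y \<omega>"
    by (rule hull_ms_integral[OF hV eqV mY cAE]; assumption)+
  have "AE \<omega> in M. 1 / fact (q - 1) * ?Y \<omega> = iter_integral a q (\<lambda>s. W s \<omega>) t"
    using iter by (intro AE_I2) simp
  moreover have "(\<lambda>\<omega>. iter_integral a q (\<lambda>s. W s \<omega>) t) \<in> borel_measurable M"
    using mY by (subst measurable_cong[OF iter]) auto
  ultimately show "(\<lambda>\<omega>. iter_integral a q (\<lambda>s. W s \<omega>) t) \<in> \<H>"
    by (intro hull_AE_eq[OF hull_scale[OF R(1)]])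
  show "AE \<omega> in M. 1 / fact (q - 1) * ms_integral M a t (\<lambda>u \<omega>. (t - u) ^ (q - 1) * h u \<omega>) \<omega>
      = iter_integral a q (\<lambda>s. W s \<omega>) t"
    using R(2) AE_space by eventually_elim (simp add: iter)
qed

text \<open>Serves twice: hull membership gives measurability of the path operators at each time,
  and in a larger hull it gives joint normality.\<close>

lemma hull_signed_op:
  assumes h: "\<And>t. t \<in> {a..b} \<Longrightarrow> h t \<in> \<H>" and W: "\<And>t. t \<in> {a..b} \<Longrightarrow> AE \<omega> in M. h t \<omega> = W t \<omega>"
    and mW: "\<And>t. t \<in> {a..b} \<Longrightarrow> W t \<in> borel_measurable M"
    and Cr: "\<And>\<omega>. \<omega> \<in> space M \<Longrightarrow> Cr_on r {a..b} (\<lambda>t. W t \<omega>)"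
    and ab: "a < b" and p: "p \<in> {- int r..int r}" and t: "t \<in> {a..b}"
  shows "(\<lambda>\<omega>. signed_op a b p (\<lambda>s. W s \<omega>) t) \<in> \<H>"
proof (cases p "0 :: int" rule: linorder_cases)
  case less
  then have k: "nat (- p) \<le> r"
    using p by auto
  note R = hull_ms_deriv_iterate[where h = h and W = W, OF h W mW Cr ab k t]
  have "(\<lambda>\<omega>. (deriv_in {a..b} ^^ nat (- p)) (\<lambda>s. W s \<omega>) t) \<in> \<H>"
    by (rule hull_AE_eq[OF R(1) R(3) R(2)])
  then show ?thesis
    using less by (simp add: signed_op_def)
next
  case equal
  then show ?thesis
    using hull_AE_eq[OF h mW W] t by (simp add: signed_op_def)
next
  case greater
  then show ?thesis
    using hull_ms_iter_integral(1)[OF h W mW Cr_on_continuous_on[OF Cr] t] by (simp add: signed_op_def)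
qed

end

section \<open>Independence, joint normality and laws of processes\<close>

text \<open>\<open>independent_families\<close> concerns sigma algebras pulled back from product
  spaces, \<open>indep_var\<close> those generated by single variables; this inclusion passes
  independence from the former to the latter.\<close>

lemma sigma_sets_linear_combination_subset:
  fixes Z :: "'i \<Rightarrow> 'w \<Rightarrow> real"
  assumes J: "finite J" "J \<subseteq> R"
  shows "sigma_sets (space M) {(\<lambda>\<omega>. \<Sum>i\<in>J. c i * Z i \<omega>) -` D \<inter> space M | D. D \<in> sets borel}
    \<subseteq> sets (vimage_algebra (space M) (\<lambda>\<omega>. \<lambda>i\<in>R. Z i \<omega>) (Pi\<^sub>M R (\<lambda>_. borel)))"
proof -
  let ?F = "\<lambda>\<omega>. \<Sum>i\<in>J. c i * Z i \<omega>"
  let ?V = "vimage_algebra (space M) (\<lambda>\<omega>. \<lambda>i\<in>R. Z i \<omega>) (Pi\<^sub>M R (\<lambda>_. borel))"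
  have "(\<lambda>x. \<Sum>i\<in>J. c i * x i) \<in> borel_measurable (Pi\<^sub>M R (\<lambda>_. borel))"
    using J by (intro borel_measurable_sum borel_measurable_times borel_measurable_const measurable_component_singleton) auto
  moreover have "(\<lambda>\<omega>. \<lambda>i\<in>R. Z i \<omega>) \<in> measurable ?V (Pi\<^sub>M R (\<lambda>_. borel))"
    by (rule measurable_vimage_algebra1) (auto simp: space_PiM)
  ultimately have "(\<lambda>\<omega>. \<Sum>i\<in>J. c i * (\<lambda>i\<in>R. Z i \<omega>) i) \<in> borel_measurable ?V"
    by (rule measurable_compose[rotated])
  also have "(\<lambda>\<omega>. \<Sum>i\<in>J. c i * (\<lambda>i\<in>R. Z i \<omega>) i) = ?F"
    using J by (intro ext sum.cong) auto
  finally have "?F \<in> borel_measurable ?V" .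
  then have "{?F -` D \<inter> space M | D. D \<in> sets borel} \<subseteq> sets ?V"
    by (auto dest: measurable_sets)
  then show ?thesis
    using sets.sigma_sets_subset[of _ ?V] by simp
qed

text \<open>A combination over the disjoint sum splits into one part from each family, and these
  parts are independent normal variables. The sum type merges families with different index types
  into one.\<close>

lemma (in prob_space) jointly_gaussian_independent_Plus:
  assumes X: "jointly_gaussian M S X" and Y: "jointly_gaussian M T Y"
    and ind: "independent_families M S X T Y"
  shows "jointly_gaussian M (S <+> T) (case_sum X Y)"
  unfolding jointly_gaussian_def
proof (intro allI impI)
  fix U :: "('b + 'c) set" and a assume U: "finite U" "U \<subseteq> S <+> T"
  define A where "A = Inl -` U"
  define B where "B = Inr -` U"
  have AB: "finite A" "finite B" "A \<subseteq> S" "B \<subseteq> T" "U = A <+> B"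
    using U by (auto simp: A_def B_def finite_vimageI elim: PlusE)
  let ?P = "\<lambda>\<omega>. \<Sum>i\<in>A. a (Inl i) * X i \<omega>" and ?Q = "\<lambda>\<omega>. \<Sum>j\<in>B. a (Inr j) * Y j \<omega>"
  have P: "normal_rv M ?P"
    using X AB unfolding jointly_gaussian_def by (elim allE[of _ A] allE[of _ "\<lambda>i. a (Inl i)"]) auto
  have Q: "normal_rv M ?Q"
    using Y AB unfolding jointly_gaussian_def by (elim allE[of _ B] allE[of _ "\<lambda>i. a (Inr i)"]) auto
  have "indep_var borel ?P borel ?Q"
    unfolding indep_var_eq
  proof (intro conjI)
    show "random_variable borel ?P" "random_variable borel ?Q"
      using P Q by (auto simp: normal_rv_def)
    show "indep_set (sigma_sets (space M) {?P -` D \<inter> space M | D. D \<in> sets borel})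
        (sigma_sets (space M) {?Q -` D \<inter> space M | D. D \<in> sets borel})"
      using ind unfolding independent_families_def indep_set_def
      by (rule indep_sets_mono_sets) 
        (use sigma_sets_linear_combination_subset[OF AB(1,3), of M "\<lambda>i. a (Inl i)" X]
          sigma_sets_linear_combination_subset[OF AB(2,4), of M "\<lambda>i. a (Inr i)" Y]
          in \<open>auto split: bool.splits\<close>)
  qed
  then have "normal_rv M (\<lambda>\<omega>. ?P \<omega> + ?Q \<omega>)"
    using P Q by (rule normal_rv_indep_add[rotated 2])
  then show "normal_rv M (\<lambda>\<omega>. \<Sum>i\<in>U. a i * case_sum X Y i \<omega>)"
    unfolding AB(5) using AB by (simp add: sum.Plus)
qed

text \<open>An uncountable \<open>T\<close> admits no common null set in general, but a law on the
  product space is determined by its values on cylinders, each of which involves finitely many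
  indices.\<close>

lemma (in prob_space) process_law_cong_AE:
  assumes X: "\<And>i. i \<in> T \<Longrightarrow> X i \<in> borel_measurable M" and Y: "\<And>i. i \<in> T \<Longrightarrow> Y i \<in> borel_measurable M"
    and eq: "\<And>i. i \<in> T \<Longrightarrow> AE \<omega> in M. X i \<omega> = Y i \<omega>"
  shows "process_law M T X = process_law M T Y"
proof -
  have mX: "(\<lambda>\<omega>. \<lambda>i\<in>T. X i \<omega>) \<in> measurable M (Pi\<^sub>M T (\<lambda>_. borel))"
    using X by (intro measurable_restrict) auto
  have mY: "(\<lambda>\<omega>. \<lambda>i\<in>T. Y i \<omega>) \<in> measurable M (Pi\<^sub>M T (\<lambda>_. borel))"
    using Y by (intro measurable_restrict) auto
  show ?thesis
    unfolding process_law_def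
  proof (rule measure_eqI_PiM_infinite)
    fix A J assume J: "finite J" "J \<subseteq> T" and A: "\<And>i. i \<in> J \<Longrightarrow> A i \<in> sets (borel :: real measure)"
    let ?E = "prod_emb T (\<lambda>_. borel) J (Pi\<^sub>E J A)"
    have E: "?E \<in> sets (Pi\<^sub>M T (\<lambda>_. borel :: real measure))"
      using J A by (intro sets_PiM_I) auto
    have "AE \<omega> in M. \<forall>i\<in>J. X i \<omega> = Y i \<omega>"
      using J eq by (intro AE_finite_allI) auto
    then have "AE \<omega> in M. \<omega> \<in> (\<lambda>\<omega>. \<lambda>i\<in>T. X i \<omega>) -` ?E \<inter> space M \<longleftrightarrow> \<omega> \<in> (\<lambda>\<omega>. \<lambda>i\<in>T. Y i \<omega>) -` ?E \<inter> space M"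
    proof eventually_elim
      case (elim \<omega>)
      then have "(\<lambda>i\<in>T \<inter> J. X i \<omega>) = (\<lambda>i\<in>T \<inter> J. Y i \<omega>)"
        by (intro restrict_ext) auto
      then show ?case
        by (simp add: prod_emb_def restrict_extensional)
    qed
    then show "emeasure (distr M (Pi\<^sub>M T (\<lambda>_. borel)) (\<lambda>\<omega>. \<lambda>i\<in>T. X i \<omega>)) ?E
        = emeasure (distr M (Pi\<^sub>M T (\<lambda>_. borel)) (\<lambda>\<omega>. \<lambda>i\<in>T. Y i \<omega>)) ?E"
      using E mX mY by (simp only: emeasure_distr, intro emeasure_eq_AE) auto
  next
    show "finite_measure (distr M (Pi\<^sub>M T (\<lambda>_. borel)) (\<lambda>\<omega>. \<lambda>i\<in>T. X i \<omega>))"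
      using mX by (rule finite_measure_distr)
  qed simp_all
qed

section \<open>The versions, their differential chain and their joint law\<close>

theorem proposition1:
  fixes M :: "'w measure"
    and r :: nat
    and t\<^sub>0 t\<^sub>1 :: real
    and \<mu> :: "real \<Rightarrow> real"
    and C :: "real \<Rightarrow> real \<Rightarrow> real"
    and f :: "int \<Rightarrow> real \<Rightarrow> 'w \<Rightarrow> real"
    and fstar :: "real \<Rightarrow> 'w \<Rightarrow> real"
    and \<kappa> :: "nat \<Rightarrow> 'w \<Rightarrow> real"
  assumes "prob_space M"
    and "t\<^sub>0 < t\<^sub>1"
    and "\<And>p t. p \<in> {- int r..int r} \<Longrightarrow> t \<in> {t\<^sub>0..t\<^sub>1} \<Longrightarrow> f p t \<in> borel_measurable M"
    and "gaussian_process M {t\<^sub>0..t\<^sub>1} (f 0) \<mu> C"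
    and "Cr_on r {t\<^sub>0..t\<^sub>1} \<mu>"
    and "Crr_on r {t\<^sub>0..t\<^sub>1} C"
    and "\<And>t. t \<in> {t\<^sub>0..t\<^sub>1} \<Longrightarrow> fstar t \<in> borel_measurable M"
    and "version_on M {t\<^sub>0..t\<^sub>1} fstar (f 0)"
    and "AE \<omega> in M. Cr_on r {t\<^sub>0..t\<^sub>1} (\<lambda>t. fstar t \<omega>)"
    and "\<And>j. j \<in> {1..r} \<Longrightarrow> square_integrable M (\<kappa> j)"
    and "\<And>k. k \<in> {1..r} \<Longrightarrow>
           version_on M {t\<^sub>0..t\<^sub>1} (f (- int k)) ((ms_deriv M {t\<^sub>0..t\<^sub>1} ^^ k) (f 0))"
    and "\<And>p. p \<in> {1..r} \<Longrightarrow>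
           version_on M {t\<^sub>0..t\<^sub>1} (f (int p))
             (\<lambda>t \<omega>. 1 / fact (p - 1) * ms_integral M t\<^sub>0 t (\<lambda>u \<omega>. (t - u) ^ (p - 1) * f 0 u \<omega>) \<omega>
                     + boundary_poly t\<^sub>0 \<kappa> p t \<omega>)"
  shows
    "(\<forall>k\<in>{1..r}.
        version_on M {t\<^sub>0..t\<^sub>1}
          (\<lambda>t \<omega>. (deriv_in {t\<^sub>0..t\<^sub>1} ^^ k) (\<lambda>s. fstar s \<omega>) t) (f (- int k)))
     \<and>
     ((\<lambda>(u, \<omega>). f 0 u \<omega>) \<in> borel_measurable (restrict_space borel {t\<^sub>0..t\<^sub>1} \<Otimes>\<^sub>M M) \<longrightarrow>
      (\<lambda>(u, \<omega>). fstar u \<omega>) \<in> borel_measurable (restrict_space borel {t\<^sub>0..t\<^sub>1} \<Otimes>\<^sub>M M) \<longrightarrow>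
      (\<integral>\<^sup>+u\<in>{t\<^sub>0..t\<^sub>1}. (\<integral>\<^sup>+\<omega>. ennreal (\<bar>f 0 u \<omega>\<bar> + \<bar>fstar u \<omega>\<bar>) \<partial>M) \<partial>lborel) < \<infinity> \<longrightarrow>
      (\<exists>g \<Omega>'.
         (\<forall>p\<in>{- int r..int r}. \<forall>t\<in>{t\<^sub>0..t\<^sub>1}. g p t \<in> borel_measurable M) \<and>
         (\<forall>p\<in>{- int r..int r}. version_on M {t\<^sub>0..t\<^sub>1} (g p) (f p)) \<and>
         \<Omega>' \<in> sets M \<and> measure M \<Omega>' = 1 \<and>
         (\<forall>\<omega>\<in>\<Omega>'. \<forall>p\<in>{- int r..int r}. \<forall>t\<in>{t\<^sub>0..t\<^sub>1}.
            g p t \<omega> = signed_op t\<^sub>0 t\<^sub>1 p (\<lambda>s. fstar s \<omega>) t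
                       + (if p > 0 then boundary_poly t\<^sub>0 \<kappa> (nat p) t \<omega> else 0)) \<and>
         (\<forall>\<omega>\<in>\<Omega>'. \<forall>p\<in>{- int r + 1..int r}. \<forall>t\<in>{t\<^sub>0<..<t\<^sub>1}.
            ((\<lambda>s. g p s \<omega>) has_real_derivative g (p - 1) t \<omega>) (at t)) \<and>
         (\<forall>\<mu>\<^sub>\<kappa> \<Sigma>\<^sub>\<kappa>.
            gaussian_process M {1..r} \<kappa> \<mu>\<^sub>\<kappa> \<Sigma>\<^sub>\<kappa> \<longrightarrow>
            independent_families M {1..r} \<kappa> {t\<^sub>0..t\<^sub>1} (f 0) \<longrightarrow>
            jointly_gaussian M ({- int r..int r} \<times> {t\<^sub>0..t\<^sub>1}) (\<lambda>(p, t). f p t) \<and>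
            process_law M ({- int r..int r} \<times> {t\<^sub>0..t\<^sub>1}) (\<lambda>(p, t). g p t)
              = process_law M ({- int r..int r} \<times> {t\<^sub>0..t\<^sub>1}) (\<lambda>(p, t). f p t))))"
proof -
  let ?I = "{t\<^sub>0..t\<^sub>1}"
  interpret prob_space M by fact
  note less = assms(2) and mf = assms(3) and GP = assms(4) and mstar = assms(7) and star = assms(8)
    and smooth = assms(9) and \<kappa> = assms(10) and fneg = assms(11) and fpos = assms(12)
  have jg: "jointly_gaussian M ?I (f 0)"
    using GP by (simp add: gaussian_process_def)
  interpret F: gaussian_family M ?I "f 0"
    by unfold_locales fact
  \<comment> \<open>The set of points with a non-smooth path need not be measurable; a null set
    covering it is removed instead.\<close>
  obtain N where N: "{\<omega> \<in> space M. \<not> Cr_on r ?I (\<lambda>t. fstar t \<omega>)} \<subseteq> N" "emeasure M N = 0" "N \<in> sets M"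
    using smooth by (rule AE_E)
  define \<Omega>' where "\<Omega>' = space M - N"
  have "prob N = 0"
    using N(2) by (simp add: measure_def)
  then have \<Omega>': "\<Omega>' \<in> sets M" "prob \<Omega>' = 1"
    using N(3) by (simp_all add: \<Omega>'_def prob_compl)
  have Cr_star: "Cr_on r ?I (\<lambda>t. fstar t \<omega>)" if "\<omega> \<in> \<Omega>'" for \<omega>
    using N(1) that by (auto simp: \<Omega>'_def)
  have AE_\<Omega>': "AE \<omega> in M. \<omega> \<in> \<Omega>'"
    using \<Omega>' by (simp add: prob_eq_1)
  obtain \<omega>\<^sub>0 where \<omega>\<^sub>0: "\<omega>\<^sub>0 \<in> \<Omega>'"
    using \<Omega>'(2) by (metis ex_in_conv measure_empty zero_neq_one)
  \<comment> \<open>Substituting one smooth path off \<open>\<Omega>'\<close> makes every path smooth and keeps \<open>W t\<close> measurable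
    although \<open>M\<close> need not be complete.\<close>
  define W where "W t \<omega> = (if \<omega> \<in> \<Omega>' then fstar t \<omega> else fstar t \<omega>\<^sub>0)" for t \<omega>
  have W_path: "(\<lambda>t. W t \<omega>) = (\<lambda>t. fstar t \<omega>)" if "\<omega> \<in> \<Omega>'" for \<omega>
    using that by (simp add: W_def)
  have mW: "W t \<in> borel_measurable M" if "t \<in> ?I" for t
    unfolding W_def using mstar[OF that] \<Omega>'(1) by (intro measurable_If_set) (auto simp: sets.Int_space_eq2)
  have Cr: "Cr_on r ?I (\<lambda>t. W t \<omega>)" for \<omega>
    using Cr_star[of \<omega>] Cr_star[OF \<omega>\<^sub>0] by (cases "\<omega> \<in> \<Omega>'") (simp_all add: W_def)
  have W: "AE \<omega> in M. f 0 t \<omega> = W t \<omega>" if "t \<in> ?I" for t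
    using star[unfolded version_on_def, rule_format, OF that] AE_\<Omega>' by eventually_elim (simp add: W_def)
  have f_neg: "AE \<omega> in M. f (- int k) t \<omega> = (deriv_in ?I ^^ k) (\<lambda>s. W s \<omega>) t" if "k \<in> {1..r}" "t \<in> ?I" for k t
  proof -
    have "k \<le> r"
      using that by simp
    with F.hull_base W mW Cr less
    have "AE \<omega> in M. (ms_deriv M ?I ^^ k) (f 0) t \<omega> = (deriv_in ?I ^^ k) (\<lambda>s. W s \<omega>) t"
      using that(2) by (rule F.hull_ms_deriv_iterate(2))
    with fneg[OF that(1), unfolded version_on_def, rule_format, OF that(2)] show ?thesis
      by eventually_elim simp
  qed
  \<comment> \<open>Built from \<open>W\<close> on the whole space: the differential chain then
    holds for every path, and the formula in terms of \<open>fstar\<close> is recovered on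
    \<open>\<Omega>'\<close>.\<close>
  define g where "g p t \<omega> = signed_op t\<^sub>0 t\<^sub>1 p (\<lambda>s. W s \<omega>) t
      + (if p > 0 then boundary_poly t\<^sub>0 \<kappa> (nat p) t \<omega> else 0)" for p t \<omega>
  have fg: "AE \<omega> in M. f p t \<omega> = g p t \<omega>" if p: "p \<in> {- int r..int r}" and t: "t \<in> ?I" for p t
  proof (cases p "0 :: int" rule: linorder_cases)
    case less
    then have "nat (- p) \<in> {1..r}" "- int (nat (- p)) = p"
      using p by auto
    then show ?thesis
      using f_neg[OF _ t, of "nat (- p)"] less by (simp add: g_def signed_op_def)
  next
    case equal
    then show ?thesis
      using W[OF t] by (simp add: g_def signed_op_def)
  next
    case greater
    define q where "q = nat p"
    have q: "q \<in> {1..r}" "p = int q" "q > 0"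
      using greater p by (auto simp: q_def)
    have "AE \<omega> in M. 1 / fact (q - 1) * ms_integral M t\<^sub>0 t (\<lambda>u \<omega>. (t - u) ^ (q - 1) * f 0 u \<omega>) \<omega>
        = iter_integral t\<^sub>0 q (\<lambda>s. W s \<omega>) t"
      using F.hull_base W mW Cr_on_continuous_on[OF Cr] t by (rule F.hull_ms_iter_integral(2))
    with fpos[OF q(1), unfolded version_on_def, rule_format, OF t] show ?thesis
      by eventually_elim (use q in \<open>simp add: g_def signed_op_def\<close>)
  qed
  have gf: "AE \<omega> in M. g p t \<omega> = f p t \<omega>" if "p \<in> {- int r..int r}" "t \<in> ?I" for p t
    using fg[OF that] by eventually_elim simp
  have m\<kappa>: "boundary_poly t\<^sub>0 \<kappa> (nat p) t \<in> borel_measurable M" if "p \<in> {- int r..int r}" for p t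
    unfolding boundary_poly_def using \<kappa> that
    by (intro borel_measurable_sum borel_measurable_times borel_measurable_const) (auto simp: square_integrable_def)
  have mg: "g p t \<in> borel_measurable M" if p: "p \<in> {- int r..int r}" and t: "t \<in> ?I" for p t
  proof -
    have "(\<lambda>\<omega>. signed_op t\<^sub>0 t\<^sub>1 p (\<lambda>s. W s \<omega>) t) \<in> F.\<H>"
      using F.hull_base W mW Cr less p t by (rule F.hull_signed_op)
    then show ?thesis
      unfolding g_def using m\<kappa>[OF p, of t] by (auto dest: F.hull_measurable)
  qed
  have version: "version_on M ?I (\<lambda>t \<omega>. (deriv_in ?I ^^ k) (\<lambda>s. fstar s \<omega>) t) (f (- int k))"
    if "k \<in> {1..r}" for k
    unfolding version_on_def
  proof
    fix t assume "t \<in> ?I"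
    from f_neg[OF that this] AE_\<Omega>'
    show "AE \<omega> in M. (deriv_in ?I ^^ k) (\<lambda>s. fstar s \<omega>) t = f (- int k) t \<omega>"
      by eventually_elim (simp add: W_path)
  qed
  have deriv: "((\<lambda>s. g p s \<omega>) has_real_derivative g (p - 1) t \<omega>) (at t)"
    if p: "p \<in> {- int r + 1..int r}" and t: "t \<in> {t\<^sub>0<..<t\<^sub>1}" for p t \<omega>
  proof -
    note S = signed_op_has_derivative[OF Cr p t, of \<omega>]
    show ?thesis
    proof (cases "p > 0")
      case False
      then show ?thesis using S by (simp add: g_def)
    next
      case True
      define n where "n = nat (p - 1)"
      have n: "nat p = Suc n" "p - 1 = int n"
        using True by (auto simp: n_def)
      \<comment> \<open>For \<open>p = 1\<close> the definition of \<open>g (p - 1)\<close> carries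
        no polynomial; the empty sum lets this case share the general formula.\<close>
      have "boundary_poly t\<^sub>0 \<kappa> 0 t \<omega> = 0"
        by (simp add: boundary_poly_def)
      then have "g (p - 1) t \<omega> = signed_op t\<^sub>0 t\<^sub>1 (p - 1) (\<lambda>s. W s \<omega>) t + boundary_poly t\<^sub>0 \<kappa> n t \<omega>"
        unfolding g_def n(2) by (cases "n = 0") auto
      then show ?thesis
        using DERIV_add[OF S boundary_poly_has_derivative[of t\<^sub>0 \<kappa> n \<omega> t]] True n(1)
        by (simp add: g_def)
    qed
  qed
  have law: "process_law M ({- int r..int r} \<times> ?I) (\<lambda>(p, t). g p t)
      = process_law M ({- int r..int r} \<times> ?I) (\<lambda>(p, t). f p t)"
  proof (rule process_law_cong_AE)
    fix i assume i: "i \<in> {- int r..int r} \<times> ?I"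
    obtain p t where pt: "i = (p, t)" "p \<in> {- int r..int r}" "t \<in> ?I"
      using i by blast
    show "(case i of (p, t) \<Rightarrow> g p t) \<in> borel_measurable M"
      "(case i of (p, t) \<Rightarrow> f p t) \<in> borel_measurable M"
      using mg mf pt by simp_all
    show "AE \<omega> in M. (case i of (p, t) \<Rightarrow> g p t) \<omega> = (case i of (p, t) \<Rightarrow> f p t) \<omega>"
      using gf[OF pt(2,3)] by (simp add: pt(1))
  qed
  have gauss: "jointly_gaussian M ({- int r..int r} \<times> ?I) (\<lambda>(p, t). f p t)"
    if \<kappa>: "gaussian_process M {1..r} \<kappa> \<mu>\<^sub>\<kappa> \<Sigma>\<^sub>\<kappa>" and ind: "independent_families M {1..r} \<kappa> ?I (f 0)"
    for \<mu>\<^sub>\<kappa> \<Sigma>\<^sub>\<kappa>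
  proof -
    \<comment> \<open>A second hull, generated by the process and the boundary variables together,
      contains both summands of every \<open>g p t\<close>; independence enters only through its
      generators.\<close>
    interpret K: gaussian_family M "{1..r} <+> ?I" "case_sum \<kappa> (f 0)"
      using jointly_gaussian_independent_Plus[OF _ jg ind] \<kappa>
      by unfold_locales (simp add: gaussian_process_def)
    have base: "f 0 t \<in> K.\<H>" if "t \<in> ?I" for t
      using K.hull_base[OF InrI[OF that]] by simp
    have base': "\<kappa> j \<in> K.\<H>" if "j \<in> {1..r}" for j
      using K.hull_base[OF InlI[OF that]] by simp
    have "f p t \<in> K.\<H>" if p: "p \<in> {- int r..int r}" and t: "t \<in> ?I" for p t
    proof -
      have S: "(\<lambda>\<omega>. signed_op t\<^sub>0 t\<^sub>1 p (\<lambda>s. W s \<omega>) t) \<in> K.\<H>"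
        using base W mW Cr less p t by (rule K.hull_signed_op)
      have B: "boundary_poly t\<^sub>0 \<kappa> (nat p) t \<in> K.\<H>"
        unfolding boundary_poly_def using p by (intro K.hull_sum K.hull_scale base') auto
      have "g p t \<in> K.\<H>"
        unfolding g_def using S K.hull_add[OF S B] by (cases "p > 0") simp_all
      then show ?thesis
        using mf[OF p t] gf[OF p t] by (rule K.hull_AE_eq)
    qed
    then show ?thesis
      by (intro K.hull_jointly_gaussian) auto
  qed
  show ?thesis
  proof (intro conjI impI exI[of _ g] exI[of _ \<Omega>'])
    show "\<forall>p\<in>{- int r..int r}. version_on M ?I (g p) (f p)"
      using gf by (simp add: version_on_def)
    show "\<forall>\<omega>\<in>\<Omega>'. \<forall>p\<in>{- int r..int r}. \<forall>t\<in>?I. g p t \<omega> = signed_op t\<^sub>0 t\<^sub>1 p (\<lambda>s. fstar s \<omega>) t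
        + (if p > 0 then boundary_poly t\<^sub>0 \<kappa> (nat p) t \<omega> else 0)"
      by (simp add: g_def W_path)
  qed (use version mg \<Omega>' deriv gauss law in auto)
qed

end
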